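(* Let $\lambda>0$. (a) For all integers $n$, $$C_\lambda(x_n)=1-\frac{\lambda_n}{4}.$$ (b) For the appropriate choice of the normalizing constant $a_\lambda$ one has, for all integers $n$, $$S_\lambda(x_n)=-\frac{\lambda_n}{4}\prod_{k=0}^\infty\Big(1+\frac{4}{2-\lambda_{n-k}}\Big),$$ and hence $$\lim_{n\to-\infty}S_\lambda(x_n)/C_\lambda(x_n)=1 .$$ (c) For all integers $n<0$, $$Q_\lambda(x_n)=-\frac34\,\frac{\lambda_n}{\lambda},$$ and hence $$\lim_{n\to-\infty}Q_\lambda(x_n)/C_\lambda(x_n)=\frac3\lambda .$$
   Context: Let $q_0,q_1,q_2$ be the vertices of an equilateral triangle in the plane (indices mod 3), $F_i(x)=\frac12(x+q_i)$, and let $SG$ (Sierpinski gasket) be the unique nonempty compact set with $SG=\bigcup_{i=0}^2F_i(SG)$. For a word $w=(w_1,\dots,w_m)\in\{0,1,2\}^m$, $|w|=m$, put $F_w=F_{w_1}\circ\cdots\circ F_{w_m}$. $V_0=\{q_0,q_1,q_2\}$, $V_m=\bigcup_iF_i(V_{m-1})$, $V_*=\bigcup_mV_m$; for distinct $x,y\in V_m$, $x\sim_my$ means $x,y$ lie in a common set $F_w(SG)$ with $|w|=m$. Laplacian: $u\in\mathrm{dom}\,\Delta$ with $\Delta u=f$ means that $u,f$ are continuous on $SG$ and $\frac32 5^m\sum_{y\sim_mx}(u(y)-u(x))\to f(x)$ as $m\to\infty$, uniformly for $x\in V_*\setminus V_0$. Normal derivative: $\partial_nu(q_0)=\lim_{m\to\infty}(5/3)^m\big(2u(q_0)-u(F_0^mq_1)-u(F_0^mq_2)\big)$.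 Tangential derivative: $\partial_Tu(q_0)=\lim_{m\to\infty}5^m\big(u(F_0^mq_1)-u(F_0^mq_2)\big)$. Infinite blow-up: $SG_\infty=\bigcup_{n\ge1}F_0^{-n}(SG)$. On $SG_\infty$, $\Delta u=f$ means that for each $n\ge0$, $\Delta(u\circ F_0^{-n})=5^{n}f\circ F_0^{-n}$ on $SG$. Let $\rho_0$ be the reflection fixing $q_0$ and interchanging $q_1,q_2$ (acting on $SG_\infty$). For $\lambda>0$, $C_\lambda,S_\lambda,Q_\lambda$ are the solutions on $SG_\infty$ of $-\Delta u=-\lambda u$ such that $C_\lambda,S_\lambda$ are even and $Q_\lambda$ is odd with respect to $\rho_0$, and $C_\lambda(q_0)=1$, $\partial_nC_\lambda(q_0)=0$; $S_\lambda(q_0)=0$, $\partial_nS_\lambda(q_0)=a_\lambda$; $\partial_TQ_\lambda(q_0)=1$. Here $a_\lambda\neq0$ is a normalization constant to be chosen. $x_n=F_0^nq_1$ for $n\in\mathbb Z$. $\{\lambda_n\}_{n\in\mathbb Z}$ is the unique sequence of negative numbers with $\lambda_{n-1}=\lambda_n(5-\lambda_n)$ for all $n$ and $-\lambda=\lim_{n\to\infty}\frac32 5^n\lambda_n$. *)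

theory Defs
  imports "HOL-Analysis.Analysis"
begin

text \<open>The three vertices are indexed by the numeral type \<^typ>\<open>3\<close> of integers mod 3.\<close>

definition equilateral :: "(3 \<Rightarrow> real^2) \<Rightarrow> bool" where
  "equilateral q \<longleftrightarrow> (\<exists>d>0. \<forall>i j. i \<noteq> j \<longrightarrow> dist (q i) (q j) = d)"

definition F :: "(3 \<Rightarrow> real^2) \<Rightarrow> 3 \<Rightarrow> real^2 \<Rightarrow> real^2" where
  "F q i x = (1/2) *\<^sub>R (x + q i)"

definition SG :: "(3 \<Rightarrow> real^2) \<Rightarrow> (real^2) set" where
  "SG q = (THE K. compact K \<and> K \<noteq> {} \<and> K = (\<Union>i. F q i ` K))"

definition Fword :: "(3 \<Rightarrow> real^2) \<Rightarrow> 3 list \<Rightarrow> real^2 \<Rightarrow> real^2" where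
  "Fword q w = foldr (\<lambda>i g. F q i \<circ> g) w id"

primrec V :: "(3 \<Rightarrow> real^2) \<Rightarrow> nat \<Rightarrow> (real^2) set" where
  "V q 0 = range q"
| "V q (Suc m) = (\<Union>i. F q i ` V q m)"

definition adj :: "(3 \<Rightarrow> real^2) \<Rightarrow> nat \<Rightarrow> real^2 \<Rightarrow> real^2 \<Rightarrow> bool" where
  "adj q m x y \<longleftrightarrow> x \<in> V q m \<and> y \<in> V q m \<and> x \<noteq> y \<and>
     (\<exists>w. length w = m \<and> x \<in> Fword q w ` SG q \<and> y \<in> Fword q w ` SG q)"

definition discrete_laplacian ::
    "(3 \<Rightarrow> real^2) \<Rightarrow> nat \<Rightarrow> (real^2 \<Rightarrow> real) \<Rightarrow> real^2 \<Rightarrow> real" where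
  "discrete_laplacian q m u x = (\<Sum>y | adj q m x y. u y - u x)"

text \<open>
  \<open>\<Delta>u = f\<close> on the gasket. The difference quotient of level \<open>m\<close> only makes sense at points
  of \<open>V\<^sub>m\<close>, so uniform convergence over all non-boundary vertices means that the error at
  level \<open>m\<close> is uniformly small over \<open>V\<^sub>m - V\<^sub>0\<close>.
\<close>

definition has_laplacian ::
    "(3 \<Rightarrow> real^2) \<Rightarrow> (real^2 \<Rightarrow> real) \<Rightarrow> (real^2 \<Rightarrow> real) \<Rightarrow> bool" where
  "has_laplacian q u f \<longleftrightarrow> continuous_on (SG q) u \<and> continuous_on (SG q) f \<and>
     (\<forall>e>0. \<exists>M. \<forall>m\<ge>M. \<forall>x \<in> V q m - V q 0.
        \<bar>3/2 * 5^m * discrete_laplacian q m u x - f x\<bar> < e)"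

definition has_normal_deriv :: "(3 \<Rightarrow> real^2) \<Rightarrow> (real^2 \<Rightarrow> real) \<Rightarrow> real \<Rightarrow> bool" where
  "has_normal_deriv q u d \<longleftrightarrow>
     (\<lambda>m. (5/3)^m * (2 * u (q 0) - u ((F q 0 ^^ m) (q 1)) - u ((F q 0 ^^ m) (q 2))))
       \<longlonglongrightarrow> d"

definition has_tangential_deriv :: "(3 \<Rightarrow> real^2) \<Rightarrow> (real^2 \<Rightarrow> real) \<Rightarrow> real \<Rightarrow> bool" where
  "has_tangential_deriv q u d \<longleftrightarrow>
     (\<lambda>m. 5^m * (u ((F q 0 ^^ m) (q 1)) - u ((F q 0 ^^ m) (q 2)))) \<longlonglongrightarrow> d"

definition F0_powi :: "(3 \<Rightarrow> real^2) \<Rightarrow> int \<Rightarrow> real^2 \<Rightarrow> real^2" where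
  "F0_powi q n = (if n \<ge> 0 then F q 0 ^^ nat n else inv (F q 0) ^^ nat (- n))"

definition SG_inf :: "(3 \<Rightarrow> real^2) \<Rightarrow> (real^2) set" where
  "SG_inf q = (\<Union>n\<in>{1::nat..}. F0_powi q (- int n) ` SG q)"

definition has_laplacian_inf ::
    "(3 \<Rightarrow> real^2) \<Rightarrow> (real^2 \<Rightarrow> real) \<Rightarrow> (real^2 \<Rightarrow> real) \<Rightarrow> bool" where
  "has_laplacian_inf q u f \<longleftrightarrow>
     (\<forall>n::nat. has_laplacian q (u \<circ> F0_powi q (- int n))
                 (\<lambda>x. 5^n * f (F0_powi q (- int n) x)))"

text \<open>
  The orthogonal reflection of the plane in the line through \<open>q\<^sub>0\<close> perpendicular to
  \<open>q\<^sub>1 - q\<^sub>2\<close>; for an equilateral triangle it interchanges \<open>q\<^sub>1\<close> and \<open>q\<^sub>2\<close>.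
\<close>

definition rho0 :: "(3 \<Rightarrow> real^2) \<Rightarrow> real^2 \<Rightarrow> real^2" where
  "rho0 q x =
     x - (2 * ((x - q 0) \<bullet> (q 1 - q 2)) / ((q 1 - q 2) \<bullet> (q 1 - q 2))) *\<^sub>R (q 1 - q 2)"

definition even_inf :: "(3 \<Rightarrow> real^2) \<Rightarrow> (real^2 \<Rightarrow> real) \<Rightarrow> bool" where
  "even_inf q u \<longleftrightarrow> (\<forall>x\<in>SG_inf q. u (rho0 q x) = u x)"

definition odd_inf :: "(3 \<Rightarrow> real^2) \<Rightarrow> (real^2 \<Rightarrow> real) \<Rightarrow> bool" where
  "odd_inf q u \<longleftrightarrow> (\<forall>x\<in>SG_inf q. u (rho0 q x) = - u x)"

text \<open>
  Real functions on the blow-up are represented by functions on the plane that are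
  \<^term>\<open>undefined\<close> outside it, so that a solution can be unique. The eigenvalue equation
  \<open>-\<Delta>u = -\<lambda>u\<close> is \<open>\<Delta>u = \<lambda>u\<close>.
\<close>

definition solution :: "(3 \<Rightarrow> real^2) \<Rightarrow> real \<Rightarrow> (real^2 \<Rightarrow> real) \<Rightarrow> bool" where
  "solution q lam u \<longleftrightarrow>
     u \<in> extensional (SG_inf q) \<and> has_laplacian_inf q u (\<lambda>x. lam * u x)"

definition C_fun :: "(3 \<Rightarrow> real^2) \<Rightarrow> real \<Rightarrow> real^2 \<Rightarrow> real" where
  "C_fun q lam = (THE u. solution q lam u \<and> even_inf q u \<and>
                         u (q 0) = 1 \<and> has_normal_deriv q u 0)"

definition S_fun :: "(3 \<Rightarrow> real^2) \<Rightarrow> real \<Rightarrow> real \<Rightarrow> real^2 \<Rightarrow> real" where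
  "S_fun q a lam = (THE u. solution q lam u \<and> even_inf q u \<and>
                           u (q 0) = 0 \<and> has_normal_deriv q u a)"

definition Q_fun :: "(3 \<Rightarrow> real^2) \<Rightarrow> real \<Rightarrow> real^2 \<Rightarrow> real" where
  "Q_fun q lam = (THE u. solution q lam u \<and> odd_inf q u \<and> has_tangential_deriv q u 1)"

end

theory Submission
  imports Defs
begin

text \<open>
  The idea is spectral decimation. Given the values of a function at the three corners of a
  cell, there is for \<open>c < 0\<close> exactly one choice of values at the three midpoints for which
  the graph eigenvalue equation with eigenvalue \<open>c\<close> holds there (\<open>extend\<close>); and if the
  coarse values satisfied the equation with eigenvalue \<open>c (5 - c)\<close> at an old vertex, the
  fine values satisfy it with eigenvalue \<open>c\<close> (\<open>flux_extend\<close>). Since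
  \<open>l (n - 1) = l n (5 - l n)\<close>, iterating the extension along the sequence \<open>l\<close> keeps the
  equation exact at every level. As \<open>l (n + m)\<close> decays like \<open>5 ^ (- m)\<close>, the extended values
  converge uniformly to a continuous function \<open>eigfun n p\<close> on the gasket, with corner values
  \<open>p\<close>, and \<open>3/2 5 ^ m l m \<longlonglongrightarrow> - lam\<close> turns the graph equations into the equation for the
  Laplacian (\<open>has_laplacian_eigfun\<close>).

  On the blow-up such functions are glued. The cell of scale \<open>n\<close> at \<open>q\<^sub>0\<close> has the corners
  \<open>q\<^sub>0\<close>, \<open>x n\<close> and the mirror image of \<open>x n\<close>, so a solution is given by corner values \<open>P n\<close>
  on all scales for which \<open>P (n + 1)\<close> is the extension of \<open>P n\<close> to the subcell at \<open>q\<^sub>0\<close>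
  (\<open>compatible\<close>, \<open>glue\<close>). With reflection symmetry this is a scalar recursion for the value
  at \<open>x n\<close>, and the three closed formulas (\<open>Cval\<close>, \<open>Sval\<close>, \<open>Qval\<close>) are solutions of it.

  The functions of the theorem are defined by description, so uniqueness is needed as well.
  For \<open>lam > 0\<close> the maximum principle shows that a solution on a cell is determined by its
  three corner values (\<open>dirichlet_unique\<close>). A symmetric solution with prescribed value at
  \<open>q\<^sub>0\<close> has only one free corner value on each cell at \<open>q\<^sub>0\<close>; it is there a combination of
  the explicit solutions, and the prescribed derivative at \<open>q\<^sub>0\<close> fixes the remaining
  coefficient independently of the size of the cell (\<open>even_solution_unique\<close>,
  \<open>odd_solution_unique\<close>).

  Finally \<open>l n\<close> tends to \<open>- \<infinity>\<close> geometrically as \<open>n\<close> decreases, so in both quotients the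
  factor \<open>- l n / 4\<close> asymptotically cancels against \<open>1 - l n / 4\<close>, and the infinite product
  tends to \<open>1\<close>.
\<close>

section \<open>Indices, barycentric coordinates and the contractions\<close>

lemma sum_three: "sum f (UNIV :: 3 set) = f 0 + f 1 + f 2"
  for f :: "3 \<Rightarrow> 'a::comm_monoid_add"
proof -
  have "(3::3) = 0" by simp
  then have "f 3 = f 0" by (rule arg_cong)
  then show ?thesis using sum_3[of f] by (simp add: add.commute add.left_commute)
qed

lemma three_cases: "i = 0 \<or> i = 1 \<or> i = (2::3)"
proof -
  have "(3::3) = 0" by simp
  then show ?thesis using exhaust_3[of i] by metis
qed

lemma UN_three: "(\<Union>i::3. T i) = T 0 \<union> T 1 \<union> T 2"
  using three_cases by (auto, metis)

lemma inner_of_dist: "(x - y) \<bullet> (x - z) = ((dist x y)\<^sup>2 + (dist x z)\<^sup>2 - (dist y z)\<^sup>2) / 2"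
  for x y z :: "'a::real_inner"
  by (simp add: dist_norm power2_norm_eq_inner inner_diff algebra_simps inner_commute)

locale gasket =
  fixes q :: "3 \<Rightarrow> real^2"
  assumes equilateral: "equilateral q"
begin

definition side :: real where "side = dist (q 0) (q 1)"

lemma dist_q: "i \<noteq> j \<Longrightarrow> dist (q i) (q j) = side"
  and side_pos: "side > 0"
proof -
  obtain d where d: "d > 0" "\<And>i j. i \<noteq> j \<Longrightarrow> dist (q i) (q j) = d"
    using equilateral unfolding equilateral_def by blast
  have "side = d" unfolding side_def by (rule d(2)) simp
  with d show "i \<noteq> j \<Longrightarrow> dist (q i) (q j) = side" "side > 0" by auto
qed

lemma inj_q: "q i = q j \<longleftrightarrow> i = j"
  using dist_q[of i j] side_pos by (metis dist_self less_irrefl)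

text \<open>
  The barycentric coordinate belonging to the corner \<open>q i\<close>: the vector \<open>3 q i - (\<Sum>j. q j)\<close>
  is perpendicular to the opposite side, and its inner product with either side at \<open>q i\<close>,
  directed towards \<open>q i\<close>, is \<open>3/2 side\<^sup>2\<close>, which explains the normalisation.
\<close>

definition bary :: "3 \<Rightarrow> real^2 \<Rightarrow> real" where
  "bary i x = 1 - 2 / (3 * side\<^sup>2) * ((q i - x) \<bullet> (3 *\<^sub>R q i - (\<Sum>j\<in>UNIV. q j)))"

lemma bary_q: "bary i (q j) = (if i = j then 1 else 0)"
proof (cases "i = j")
  case True
  then show ?thesis by (simp add: bary_def)
next
  case False
  have "(q i - q j) \<bullet> (3 *\<^sub>R q i - (\<Sum>k\<in>UNIV. q k)) = (\<Sum>k\<in>UNIV. (q i - q j) \<bullet> (q i - q k))"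
    by (simp add: sum_three inner_diff inner_add algebra_simps)
  also have "\<dots> = 3 / 2 * side\<^sup>2"
  proof -
    have e: "(q i - q j) \<bullet> (q i - q k) = (if k = i then 0 else if k = j then side\<^sup>2 else side\<^sup>2 / 2)" for k
      using False dist_q[of i j] dist_q[of i k] dist_q[of j k] by (auto simp: inner_of_dist)
    show ?thesis unfolding e
      using False three_cases[of i] three_cases[of j] by (auto simp: sum_three)
  qed
  finally have "(q i - q j) \<bullet> (3 *\<^sub>R q i - (\<Sum>k\<in>UNIV. q k)) = 3 / 2 * side\<^sup>2" .
  with False side_pos show ?thesis by (simp add: bary_def)
qed

lemma bary_F: "bary i (F q j y) = (bary i y + (if i = j then 1 else 0)) / 2"
proof -
  have "bary i (F q j y) = (bary i y + bary i (q j)) / 2"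
  proof -
    let ?n = "3 *\<^sub>R q i - (\<Sum>j\<in>UNIV. q j)"
    have "q i - F q j y = (1/2) *\<^sub>R ((q i - y) + (q i - q j))"
      by (simp add: F_def algebra_simps flip: scaleR_2)
    then have "(q i - F q j y) \<bullet> ?n = ((q i - y) \<bullet> ?n + (q i - q j) \<bullet> ?n) / 2"
      by (simp only: inner_scaleR_left inner_add_left)
    moreover have "1 - K * X = ((1 - K * Y) + (1 - K * Z)) / 2" if "X = (Y + Z) / 2" for K X Y Z :: real
      using that by (simp add: field_simps)
    ultimately show ?thesis unfolding bary_def by blast
  qed
  then show ?thesis by (simp add: bary_q)
qed

lemma continuous_on_bary: "continuous_on S (bary i)"
  unfolding bary_def by (intro continuous_intros)

lemma continuous_on_F: "continuous_on S (F q i)"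
  unfolding F_def by (intro continuous_intros)

lemma F_inj: "F q i x = F q i y \<longleftrightarrow> x = y"
  by (simp add: F_def)

lemma F_q: "F q i (q i) = q i"
  by (simp add: F_def scaleR_half_double[symmetric] flip: scaleR_2)

lemma F_q_commute: "F q i (q j) = F q j (q i)"
  by (simp add: F_def add.commute)

lemma dist_F: "dist (F q i x) (F q i y) = dist x y / 2"
proof -
  have "F q i x - F q i y = (1/2) *\<^sub>R (x - y)" by (simp add: F_def algebra_simps)
  then show ?thesis by (simp add: dist_norm)
qed

section \<open>Vertices and the gasket\<close>

definition Vstar :: "(real^2) set" where "Vstar = (\<Union>m. V q m)"

lemma q_in_V: "q i \<in> V q m"
  by (induction m) (auto, metis F_q image_eqI)

lemma V_mono: "m \<le> k \<Longrightarrow> V q m \<subseteq> V q k"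
proof (rule lift_Suc_mono_le)
  fix m show "V q m \<subseteq> V q (Suc m)"
  proof (induction m)
    case 0
    have "q i \<in> F q i ` V q 0" for i using F_q[of i] by (metis V.simps(1) image_eqI rangeI)
    then show ?case by auto
  next
    case (Suc m)
    show ?case
      by (subst (1 2) V.simps(2)) (rule UN_mono[OF subset_refl image_mono[OF Suc]])
  qed
qed auto

lemma finite_V: "finite (V q m)"
  by (induction m) auto

lemma Vstar_eq: "Vstar = (\<Union>i. F q i ` Vstar)"
proof -
  have "Vstar = (\<Union>m. V q (Suc m))"
    unfolding Vstar_def using V_mono[of m "Suc m" for m] by (blast intro: le_SucI)
  also have "\<dots> = (\<Union>i. F q i ` Vstar)" unfolding Vstar_def V.simps by blast
  finally show ?thesis .
qed

text \<open>
  The vertices form the smallest set that contains the corners and is mapped into itself by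
  the three contractions.
\<close>

lemma Vstar_invariant_induct [consumes 1, case_names corner cell]:
  assumes "x \<in> Vstar" "\<And>j. P (q j)" "\<And>i y. y \<in> Vstar \<Longrightarrow> P y \<Longrightarrow> P (F q i y)"
  shows "P x"
proof -
  have "\<forall>x\<in>V q m. P x" for m
  proof (induction m)
    case (Suc m)
    then show ?case using assms(3) unfolding Vstar_def by auto
  qed (use assms(2) in auto)
  then show ?thesis using assms(1) unfolding Vstar_def by blast
qed

lemma bounded_Vstar: "bounded Vstar"
proof -
  define B where "B = Max (range (\<lambda>i. norm (q i)))"
  have B: "norm (q i) \<le> B" for i unfolding B_def by simp
  have "norm x \<le> B" if "x \<in> Vstar" for x
    using that
  proof (induction rule: Vstar_invariant_induct)
    case (cell i y)
    have "norm (F q i y) \<le> (norm y + norm (q i)) / 2"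
      unfolding F_def using norm_triangle_ineq[of y "q i"] by simp
    with cell B[of i] show ?case by simp
  qed (rule B)
  then show ?thesis unfolding bounded_iff by blast
qed

lemma closure_F_image: "closure (F q i ` S) = F q i ` closure S"
proof -
  have "F q i = (\<lambda>x. (1/2) *\<^sub>R q i + x) \<circ> (\<lambda>x. (1/2) *\<^sub>R x)"
    by (auto simp: F_def algebra_simps)
  then show ?thesis
    by (simp only: image_comp[symmetric] closure_translation closure_scaleR)
qed

lemma closure_UN_three: fixes S :: "3 \<Rightarrow> (real^2) set" shows "closure (\<Union>i::3. S i) = (\<Union>i. closure (S i))"
  unfolding UN_three by (simp add: closure_Un)

text \<open>
  A point of \<open>K\<close> farthest from \<open>L\<close> is the image of another point of \<open>K\<close> under a contraction
  with factor \<open>1/2\<close> that maps \<open>L\<close> into itself, so the maximal distance is at most half of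
  itself.
\<close>

lemma attractor_subset:
  assumes K: "compact K" "K = (\<Union>i. F q i ` K)"
    and L: "compact L" "L \<noteq> {}" "L = (\<Union>i. F q i ` L)"
  shows "K \<subseteq> L"
proof (cases "K = {}")
  case False
  have cl: "closed L" using L(1) by (rule compact_imp_closed)
  obtain x where x: "x \<in> K" and max: "\<And>z. z \<in> K \<Longrightarrow> infdist z L \<le> infdist x L"
    using continuous_attains_sup[OF K(1) False continuous_on_infdist[OF continuous_on_id]] by blast
  obtain i y where y: "y \<in> K" "x = F q i y" using x K(2) by blast
  obtain z where z: "z \<in> L" "infdist y L = dist y z" using infdist_attains_inf[OF cl L(2)] by blast
  have "F q i z \<in> L" using z L(3) by blast
  then have "infdist x L \<le> dist x (F q i z)" by (rule infdist_le)
  also have "\<dots> = infdist y L / 2" using y z by (simp add: dist_F)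
  also have "\<dots> \<le> infdist x L / 2" using max[OF y(1)] by simp
  finally have "infdist x L \<le> 0" by simp
  then have "infdist w L = 0" if "w \<in> K" for w
    using max[OF that] infdist_nonneg[of w L] by linarith
  then show ?thesis using in_closed_iff_infdist_zero[OF cl L(2)] by blast
qed auto

text \<open>
  The closure of the vertex set is compact and self-similar, and by the previous lemma, used
  in both directions, it is the only such set. Working with a closure makes every closed
  condition on the gasket, and every inequality between continuous functions, checkable on
  vertices.
\<close>

lemma SG_eq_closure: "SG q = closure Vstar"
proof -
  have fixpoint: "compact (closure Vstar) \<and> closure Vstar \<noteq> {} \<and> closure Vstar = (\<Union>i. F q i ` closure Vstar)"
  proof (intro conjI)
    show "compact (closure Vstar)" using bounded_Vstar by (simp add: compact_closure)
    show "closure Vstar \<noteq> {}" using q_in_V[of 0 0] unfolding Vstar_def closure_eq_empty by blast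
    have "closure (\<Union>i. F q i ` Vstar) = (\<Union>i. closure (F q i ` Vstar))"
      by (rule closure_UN_three)
    then show "closure Vstar = (\<Union>i. F q i ` closure Vstar)"
      unfolding Vstar_eq[symmetric] closure_F_image .
  qed
  show ?thesis
    unfolding SG_def
  proof (rule the_equality[where P="\<lambda>K. compact K \<and> K \<noteq> {} \<and> K = (\<Union>i. F q i ` K)", OF fixpoint])
    fix K assume "compact K \<and> K \<noteq> {} \<and> K = (\<Union>i. F q i ` K)"
    note K = conjunct1[OF this] conjunct1[OF conjunct2[OF this]] conjunct2[OF conjunct2[OF this]]
    note L = conjunct1[OF fixpoint] conjunct1[OF conjunct2[OF fixpoint]] conjunct2[OF conjunct2[OF fixpoint]]
    show "K = closure Vstar"
      by (rule subset_antisym[OF attractor_subset[OF K(1,3) L] attractor_subset[OF L(1,3) K]])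
  qed
qed

lemma SG_unfold: "SG q = (\<Union>i. F q i ` SG q)"
proof -
  have "closure (\<Union>i. F q i ` Vstar) = (\<Union>i. closure (F q i ` Vstar))"
    by (rule closure_UN_three)
  then have "closure Vstar = (\<Union>i. F q i ` closure Vstar)"
    unfolding Vstar_eq[symmetric] closure_F_image .
  then show ?thesis unfolding SG_eq_closure .
qed

lemma compact_SG: "compact (SG q)"
  using bounded_Vstar by (simp add: compact_closure SG_eq_closure)

lemma F_in_SG: "y \<in> SG q \<Longrightarrow> F q i y \<in> SG q"
  using SG_unfold by blast

lemma SG_cases:
  assumes "x \<in> SG q" obtains i y where "y \<in> SG q" "x = F q i y"
  using assms SG_unfold by blast

lemma Vstar_subset_SG: "Vstar \<subseteq> SG q"
  by (simp add: SG_eq_closure closure_subset)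

lemma V_subset_SG: "V q m \<subseteq> SG q"
  using Vstar_subset_SG unfolding Vstar_def by blast

lemma q_in_SG: "q i \<in> SG q"
  using V_subset_SG q_in_V by blast

text \<open>
  These conditions describe the closed triangle. They are closed, hold at the corners, and
  are inherited under the contractions.
\<close>

lemma SG_triangle:
  assumes "x \<in> SG q"
  shows "bary i x \<ge> 0" "(\<Sum>i\<in>UNIV. bary i x) = 1" "x = (\<Sum>i\<in>UNIV. bary i x *\<^sub>R q i)"
proof -
  define T where "T = {x. \<forall>i. 0 \<le> bary i x} \<inter> {x. (\<Sum>i\<in>UNIV. bary i x) = 1}
    \<inter> {x. x = (\<Sum>i\<in>UNIV. bary i x *\<^sub>R q i)}"
  have "closed T"
    unfolding T_def bary_def
    by (intro closed_Int closed_Collect_eq closed_Collect_all closed_Collect_le continuous_intros)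
  moreover have "Vstar \<subseteq> T"
  proof
    fix x assume "x \<in> Vstar"
    then show "x \<in> T"
    proof (induction rule: Vstar_invariant_induct)
      case (corner j)
      then show ?case
        using three_cases[of j] by (auto simp: T_def bary_q sum_three)
    next
      case (cell i y)
      then have *: "\<forall>k. 0 \<le> bary k y" "(\<Sum>k\<in>UNIV. bary k y) = 1" "(\<Sum>k\<in>UNIV. bary k y *\<^sub>R q k) = y"
        by (auto simp: T_def)
      have "(\<Sum>k\<in>UNIV. bary k (F q i y)) = ((\<Sum>k\<in>UNIV. bary k y) + (\<Sum>k\<in>UNIV. if k = i then 1 else 0)) / 2"
        by (simp only: bary_F sum_divide_distrib[symmetric] sum.distrib)
      moreover have "(\<Sum>k\<in>UNIV. bary k (F q i y) *\<^sub>R q k)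
          = (1/2) *\<^sub>R ((\<Sum>k\<in>UNIV. bary k y *\<^sub>R q k) + (\<Sum>k\<in>UNIV. (if k = i then 1 else 0) *\<^sub>R q k))"
        unfolding sum.distrib[symmetric] scaleR_sum_right
        by (intro sum.cong refl) (simp add: bary_F scaleR_add_left[symmetric])
      moreover have "(\<Sum>k\<in>UNIV. (if k = i then 1 else 0) *\<^sub>R q k) = q i"
        by (simp add: if_distrib[of "\<lambda>a. a *\<^sub>R _"] cong: if_cong)
      moreover have "0 \<le> bary k (F q i y)" for k using *(1) by (simp add: bary_F)
      ultimately show ?case
        unfolding T_def using * by (auto simp: F_def[of q i y])
    qed
  qed
  ultimately have "x \<in> T" using assms closure_minimal unfolding SG_eq_closure by blast
  then show "bary i x \<ge> 0" "(\<Sum>i\<in>UNIV. bary i x) = 1" "x = (\<Sum>i\<in>UNIV. bary i x *\<^sub>R q i)"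
    unfolding T_def by auto
qed

lemma bary_le_1: assumes "x \<in> SG q" shows "bary i x \<le> 1"
  using SG_triangle[OF assms] member_le_sum[of i UNIV "\<lambda>i. bary i x"] by auto

lemma bary_eq_1: assumes "x \<in> SG q" "bary i x = 1" shows "x = q i"
proof -
  have s: "(\<Sum>j\<in>UNIV - {i}. bary j x) = 0"
    using SG_triangle(2)[OF assms(1)] assms(2) by (simp add: sum.remove[of UNIV i])
  have "\<forall>j\<in>UNIV - {i}. bary j x = 0"
    using s SG_triangle(1)[OF assms(1)] by (subst (asm) sum_nonneg_eq_0_iff) auto
  then have "(\<Sum>j\<in>UNIV. bary j x *\<^sub>R q j) = q i"
    using assms(2) by (subst sum.remove[of UNIV i]) auto
  then show ?thesis using SG_triangle(3)[OF assms(1)] by simp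
qed

text \<open>
  In the cell of \<open>i\<close> the coordinate \<open>bary i\<close> is at least \<open>1/2\<close>, in the other cell it is at
  most \<open>1/2\<close>. A common point therefore has two coordinates equal to \<open>1/2\<close> and is the
  midpoint of a side.
\<close>

lemma cells_meet:
  assumes "x \<in> SG q" "y \<in> SG q" "F q i x = F q j y" "i \<noteq> j"
  shows "x = q j" "y = q i"
proof -
  have "bary i x + 1 = bary i y" "bary j x = bary j y + 1"
    using arg_cong[OF assms(3), of "bary i"] arg_cong[OF assms(3), of "bary j"] assms(4)
    by (auto simp: bary_F)
  then have "bary j x = 1" "bary i y = 1"
    using bary_le_1[OF assms(1), of j] bary_le_1[OF assms(2), of i]
      SG_triangle(1)[OF assms(1), of i] SG_triangle(1)[OF assms(2), of j] by linarith+
  then show "x = q j" "y = q i" using assms bary_eq_1 by auto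
qed

lemma corner_cell:
  assumes "x \<in> SG q" "F q i x = q j" shows "i = j" "x = q j"
proof -
  show "i = j"
  proof (rule ccontr)
    assume ne: "i \<noteq> j"
    have "F q i x = F q j (q j)" using assms F_q by simp
    from cells_meet(2)[OF assms(1) q_in_SG this ne] show False using ne inj_q by simp
  qed
  then show "x = q j" using assms F_inj[of j x "q j"] F_q by simp
qed

lemma SG_continuous_extend_le:
  fixes f g :: "real^2 \<Rightarrow> real"
  assumes "continuous_on (SG q) f" "continuous_on (SG q) g" "\<And>x. x \<in> Vstar \<Longrightarrow> f x \<le> g x" "x \<in> SG q"
  shows "f x \<le> g x"
proof -
  have "(\<lambda>x. g x - f x) x \<ge> 0"
  proof (rule continuous_ge_on_closure[where S=Vstar])
    show "continuous_on (closure Vstar) (\<lambda>x. g x - f x)"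
      using assms SG_eq_closure by (auto intro: continuous_intros)
  qed (use assms SG_eq_closure in auto)
  then show ?thesis by simp
qed

section \<open>The graph Laplacians and the maximum principle\<close>

lemma Fword_Nil: "Fword q [] = id" and Fword_Cons: "Fword q (i # w) = F q i \<circ> Fword q w"
  by (simp_all add: Fword_def)

lemma Fword_SG: "y \<in> SG q \<Longrightarrow> Fword q w y \<in> SG q"
  by (induction w) (auto simp: Fword_Nil Fword_Cons F_in_SG)

text \<open>
  If the vertex \<open>F q i x\<close> was produced by a different contraction, then it is a junction of
  two cells and \<open>x\<close> is a corner, which is a vertex of every level.
\<close>

lemma preimage_in_V:
  assumes "x \<in> SG q" "F q i x \<in> V q (Suc m)" shows "x \<in> V q m"
proof -
  obtain j y where y: "y \<in> V q m" "F q i x = F q j y" using assms(2) by auto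
  show ?thesis
  proof (cases "i = j")
    case True
    then show ?thesis using y F_inj by auto
  next
    case False
    then show ?thesis using cells_meet(1)[OF assms(1) _ y(2)] y(1) V_subset_SG q_in_V by blast
  qed
qed

lemma adj_Suc:
  "adj q (Suc m) x y \<longleftrightarrow> (\<exists>i x' y'. x = F q i x' \<and> y = F q i y' \<and> adj q m x' y')"
proof
  assume a: "adj q (Suc m) x y"
  then obtain w where w: "length w = Suc m" "x \<in> Fword q w ` SG q" "y \<in> Fword q w ` SG q"
    unfolding adj_def by blast
  obtain i v where v: "w = i # v" "length v = m" using w(1) by (cases w) auto
  obtain x0 y0 where "x0 \<in> SG q" "y0 \<in> SG q" "x = F q i (Fword q v x0)" "y = F q i (Fword q v y0)"
    using w v by (auto simp: Fword_Cons)
  with a v show "\<exists>i x' y'. x = F q i x' \<and> y = F q i y' \<and> adj q m x' y'"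
    unfolding adj_def
    by (intro exI[of _ i] exI[of _ "Fword q v x0"] exI[of _ "Fword q v y0"] conjI exI[of _ v])
      (auto simp del: V.simps simp: Fword_SG F_inj intro: preimage_in_V)
next
  assume "\<exists>i x' y'. x = F q i x' \<and> y = F q i y' \<and> adj q m x' y'"
  then obtain i x' y' w where *: "x = F q i x'" "y = F q i y'" "x' \<in> V q m" "y' \<in> V q m" "x' \<noteq> y'"
     "length w = m" "x' \<in> Fword q w ` SG q" "y' \<in> Fword q w ` SG q"
    unfolding adj_def by blast
  then show "adj q (Suc m) x y"
    unfolding adj_def
    by (intro conjI exI[of _ "i # w"]) (auto simp: Fword_Cons image_comp[symmetric] F_inj)
qed

lemma adj_SG: "adj q m x y \<Longrightarrow> x \<in> SG q" "adj q m x y \<Longrightarrow> y \<in> SG q"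
  using V_subset_SG unfolding adj_def by blast+

lemma finite_adj: "finite {y. adj q m x y}"
  by (rule finite_subset[OF _ finite_V[of m]]) (auto simp: adj_def)

lemma discrete_laplacian_cong:
  assumes "\<And>y. y \<in> SG q \<Longrightarrow> u y = v y" "x \<in> SG q"
  shows "discrete_laplacian q m u x = discrete_laplacian q m v x"
  unfolding discrete_laplacian_def using assms adj_SG by (intro sum.cong) auto

lemma discrete_laplacian_0: "discrete_laplacian q 0 u (q j) = (\<Sum>k\<in>UNIV. u (q k) - u (q j))"
proof -
  have "{y. adj q 0 (q j) y} = q ` (UNIV - {j})"
    using q_in_SG by (auto simp: adj_def Fword_Nil inj_q)
  then have "discrete_laplacian q 0 u (q j) = (\<Sum>k\<in>UNIV - {j}. u (q k) - u (q j))"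
    unfolding discrete_laplacian_def by (simp add: sum.reindex inj_on_def inj_q)
  then show ?thesis by (simp add: sum.remove[of UNIV j])
qed

lemma sum_F_image:
  "(\<Sum>y\<in>F q i ` S. u y - u (F q i x)) = (\<Sum>y\<in>S. (u \<circ> F q i) y - (u \<circ> F q i) x)"
  by (simp add: sum.reindex inj_on_def F_inj)

text \<open>
  This lemma and the next two express the Laplacian of level \<open>m + 1\<close> through that of level
  \<open>m\<close> on the cells. The neighbours of a point are found in the cells that contain it: only
  one cell, unless the point is a junction, where the two one-sided sums add up.
\<close>

lemma discrete_laplacian_corner:
  "discrete_laplacian q (Suc m) u (q j) = discrete_laplacian q m (u \<circ> F q j) (q j)"
proof -
  have "{y. adj q (Suc m) (q j) y} = F q j ` {y. adj q m (q j) y}"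
  proof (intro equalityI subsetI)
    fix y assume "y \<in> {y. adj q (Suc m) (q j) y}"
    then obtain i x' y' where "q j = F q i x'" "y = F q i y'" "adj q m x' y'" by (auto simp: adj_Suc)
    with corner_cell[of x' i j] adj_SG show "y \<in> F q j ` {y. adj q m (q j) y}" by auto
  next
    fix y assume "y \<in> F q j ` {y. adj q m (q j) y}"
    then obtain z where "y = F q j z" "adj q m (q j) z" by blast
    then show "y \<in> {y. adj q (Suc m) (q j) y}"
      unfolding adj_Suc mem_Collect_eq using F_q[of j, symmetric] by blast
  qed
  then show ?thesis
    unfolding discrete_laplacian_def using sum_F_image[of u j "q j"] by (simp only: F_q)
qed

lemma discrete_laplacian_interior:
  assumes "x \<in> V q m - V q 0"
  shows "discrete_laplacian q (Suc m) u (F q i x) = discrete_laplacian q m (u \<circ> F q i) x"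
proof -
  have x: "x \<in> SG q" "\<And>j. x \<noteq> q j" using assms V_subset_SG by auto
  have "{y. adj q (Suc m) (F q i x) y} = F q i ` {y. adj q m x y}"
  proof (intro equalityI subsetI)
    fix y assume "y \<in> {y. adj q (Suc m) (F q i x) y}"
    then obtain j x' y' where *: "F q i x = F q j x'" "y = F q j y'" "adj q m x' y'" by (auto simp: adj_Suc)
    have "i = j" using cells_meet(1)[OF x(1) adj_SG(1)[OF *(3)] *(1)] x(2)[of j] by metis
    with * show "y \<in> F q i ` {y. adj q m x y}" by (simp add: F_inj)
  next
    fix y assume "y \<in> F q i ` {y. adj q m x y}"
    then show "y \<in> {y. adj q (Suc m) (F q i x) y}" unfolding adj_Suc mem_Collect_eq by blast
  qed
  then show ?thesis
    unfolding discrete_laplacian_def by (simp only: sum_F_image)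
qed

lemma discrete_laplacian_junction:
  assumes "i \<noteq> j"
  shows "discrete_laplacian q (Suc m) u (F q i (q j))
    = discrete_laplacian q m (u \<circ> F q i) (q j) + discrete_laplacian q m (u \<circ> F q j) (q i)"
proof -
  let ?x = "F q i (q j)"
  have x: "?x = F q j (q i)" by (rule F_q_commute)
  have eq: "{y. adj q (Suc m) ?x y} = F q i ` {y. adj q m (q j) y} \<union> F q j ` {y. adj q m (q i) y}"
  proof (intro equalityI subsetI)
    fix y assume "y \<in> {y. adj q (Suc m) ?x y}"
    then obtain k x' y' where *: "?x = F q k x'" "y = F q k y'" "adj q m x' y'" by (auto simp: adj_Suc)
    have x': "x' \<in> SG q" using * adj_SG by blast
    show "y \<in> F q i ` {y. adj q m (q j) y} \<union> F q j ` {y. adj q m (q i) y}"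
    proof (cases "k = i")
      case True
      then have "x' = q j" using *(1) by (simp add: F_inj)
      then show ?thesis using * True by blast
    next
      case False
      then have "q j = q k" "x' = q i"
        using cells_meet[OF q_in_SG x' *(1)] by metis+
      then show ?thesis using * by (simp add: inj_q)
    qed
  next
    fix y assume "y \<in> F q i ` {y. adj q m (q j) y} \<union> F q j ` {y. adj q m (q i) y}"
    then have "\<exists>k a b. ?x = F q k a \<and> y = F q k b \<and> adj q m a b" using x by blast
    then show "y \<in> {y. adj q (Suc m) ?x y}" by (simp add: adj_Suc)
  qed
  have disj: "F q i ` {y. adj q m (q j) y} \<inter> F q j ` {y. adj q m (q i) y} = {}"
  proof -
    have False if "adj q m (q j) y" "adj q m (q i) z" "F q i y = F q j z" for y z
      using cells_meet(1)[OF adj_SG(2)[OF that(1)] adj_SG(2)[OF that(2)] that(3) assms] that(1)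
      by (simp add: adj_def)
    then show ?thesis by blast
  qed
  have "discrete_laplacian q (Suc m) u ?x
     = (\<Sum>y\<in>F q i ` {y. adj q m (q j) y}. u y - u ?x) + (\<Sum>y\<in>F q j ` {y. adj q m (q i) y}. u y - u ?x)"
    unfolding discrete_laplacian_def eq by (rule sum.union_disjoint) (intro finite_imageI finite_adj disj)+
  also have "\<dots> = discrete_laplacian q m (u \<circ> F q i) (q j) + discrete_laplacian q m (u \<circ> F q j) (q i)"
    unfolding discrete_laplacian_def sum_F_image[symmetric] using x by simp
  finally show ?thesis .
qed

lemma V_Suc_cases:
  assumes "x \<in> V q (Suc m) - V q 0"
  obtains (interior) i y where "y \<in> V q m - V q 0" "x = F q i y"
    | (junction) i j where "i \<noteq> j" "x = F q i (q j)"
proof -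
  obtain i y where y: "y \<in> V q m" "x = F q i y" using assms by auto
  show thesis
  proof (cases "y \<in> V q 0")
    case True
    then obtain j where j: "y = q j" by auto
    moreover have "i \<noteq> j"
    proof
      assume "i = j"
      then have "x = q j" using y j F_q by simp
      then show False using assms by simp
    qed
    ultimately show thesis using junction[of i j] y by simp
  next
    case False
    then show thesis using interior y by blast
  qed
qed

text \<open>
  At a vertex where \<open>v\<close> is maximal among the vertices of level \<open>m\<close> the graph Laplacian is
  not positive. It approximates \<open>c * v\<close> up to an error that is uniformly small, so an
  interior maximum is at most as large as this error divided by \<open>c\<close>. Letting \<open>m\<close> grow gives
  the claim on all vertices.
\<close>

lemma dirichlet_max_principle:
  assumes lap: "has_laplacian q v (\<lambda>x. c * v x)" and c: "c > 0"
    and bd: "\<And>j. v (q j) \<le> 0" and x: "x \<in> SG q"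
  shows "v x \<le> 0"
proof (rule SG_continuous_extend_le[OF _ _ _ x, where g="\<lambda>_. 0"])
  show "continuous_on (SG q) v" using lap by (simp add: has_laplacian_def)
  fix y assume "y \<in> Vstar"
  then obtain k where k: "y \<in> V q k" unfolding Vstar_def by blast
  show "v y \<le> 0"
  proof (rule field_le_epsilon)
    fix e :: real assume e: "e > 0"
    then obtain M where M: "\<And>m x. m \<ge> M \<Longrightarrow> x \<in> V q m - V q 0 \<Longrightarrow>
        \<bar>3/2 * 5^m * discrete_laplacian q m v x - c * v x\<bar> < c * e"
      using lap c unfolding has_laplacian_def by (metis mult_pos_pos)
    define m where "m = max M k"
    have y: "y \<in> V q m" using k V_mono[of k m] by (auto simp: m_def)
    have "Max (v ` V q m) \<in> v ` V q m" using finite_V y by (intro Max_in) auto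
    then obtain z where z: "z \<in> V q m" "v z = Max (v ` V q m)" by (metis imageE)
    have le: "v w \<le> v z" if "w \<in> V q m" for w using that z(2) finite_V by simp
    have "v z \<le> e"
    proof (cases "z \<in> V q 0")
      case True
      then obtain j where "z = q j" by auto
      then show ?thesis using bd[of j] e by simp
    next
      case False
      have "discrete_laplacian q m v z \<le> 0"
        unfolding discrete_laplacian_def by (rule sum_nonpos) (use le in \<open>auto simp: adj_def\<close>)
      then have "3/2 * 5^m * discrete_laplacian q m v z \<le> 0" by (simp add: mult_nonneg_nonpos)
      moreover have "\<bar>3/2 * 5^m * discrete_laplacian q m v z - c * v z\<bar> < c * e"
        using M[of m z] z False by (simp add: m_def)
      ultimately have "c * v z < c * e" by linarith
      then show ?thesis using c by simp
    qed
    then show "v y \<le> 0 + e" using le[OF y] by simp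
  qed
qed simp

lemma has_laplacian_cong:
  assumes "has_laplacian q u f" "\<And>x. x \<in> SG q \<Longrightarrow> u x = v x" "\<And>x. x \<in> SG q \<Longrightarrow> f x = g x"
  shows "has_laplacian q v g"
proof -
  have eq: "discrete_laplacian q m v x = discrete_laplacian q m u x" "f x = g x" if "x \<in> V q m - V q 0" for m x
    using that V_subset_SG[of m] assms discrete_laplacian_cong[of v u x m] by auto
  then have "\<bar>3/2 * 5^m * discrete_laplacian q m v x - g x\<bar> = \<bar>3/2 * 5^m * discrete_laplacian q m u x - f x\<bar>"
    if "x \<in> V q m - V q 0" for m x by (simp only: eq[OF that])
  moreover have "continuous_on (SG q) v" "continuous_on (SG q) g"
    using assms unfolding has_laplacian_def by (auto cong: continuous_on_cong)
  ultimately show ?thesis using assms(1) unfolding has_laplacian_def by (auto simp del: V.simps)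
qed

lemma discrete_laplacian_diff:
  "discrete_laplacian q m (\<lambda>x. u x - v x) x = discrete_laplacian q m u x - discrete_laplacian q m v x"
  unfolding discrete_laplacian_def sum_subtractf[symmetric] by (rule sum.cong) auto

lemma has_laplacian_diff:
  assumes "has_laplacian q u f" "has_laplacian q v g"
  shows "has_laplacian q (\<lambda>x. u x - v x) (\<lambda>x. f x - g x)"
  unfolding has_laplacian_def
proof (intro conjI allI impI)
  fix e :: real assume "e > 0"
  then have e2: "e / 2 > 0" by simp
  obtain M where M: "\<And>m x. m \<ge> M \<Longrightarrow> x \<in> V q m - V q 0 \<Longrightarrow>
      \<bar>3/2 * 5^m * discrete_laplacian q m u x - f x\<bar> < e / 2"
    using assms(1) e2 unfolding has_laplacian_def by metis
  obtain N where N: "\<And>m x. m \<ge> N \<Longrightarrow> x \<in> V q m - V q 0 \<Longrightarrow>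
      \<bar>3/2 * 5^m * discrete_laplacian q m v x - g x\<bar> < e / 2"
    using assms(2) e2 unfolding has_laplacian_def by metis
  have "\<bar>3/2 * 5^m * discrete_laplacian q m (\<lambda>x. u x - v x) x - (f x - g x)\<bar> < e"
    if "m \<ge> max M N" "x \<in> V q m - V q 0" for m x
  proof -
    have "3/2 * 5^m * discrete_laplacian q m (\<lambda>x. u x - v x) x
        = 3/2 * 5^m * discrete_laplacian q m u x - 3/2 * 5^m * discrete_laplacian q m v x"
      by (simp add: discrete_laplacian_diff right_diff_distrib)
    then show ?thesis using M[of m x] N[of m x] that by linarith
  qed
  then show "\<exists>M. \<forall>m\<ge>M. \<forall>x\<in>V q m - V q 0.
      \<bar>3/2 * 5^m * discrete_laplacian q m (\<lambda>x. u x - v x) x - (f x - g x)\<bar> < e" by blast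
qed (use assms in \<open>auto simp: has_laplacian_def intro: continuous_intros\<close>)

lemma dirichlet_unique:
  assumes "has_laplacian q u (\<lambda>x. c * u x)" "has_laplacian q v (\<lambda>x. c * v x)" "c > 0"
    and "\<And>j. u (q j) = v (q j)" "x \<in> SG q"
  shows "u x = v x"
proof (rule antisym)
  have "has_laplacian q (\<lambda>x. u x - v x) (\<lambda>x. c * (u x - v x))"
    "has_laplacian q (\<lambda>x. v x - u x) (\<lambda>x. c * (v x - u x))"
    using has_laplacian_diff[OF assms(1,2)] has_laplacian_diff[OF assms(2,1)]
    by (simp_all add: right_diff_distrib)
  from dirichlet_max_principle[OF this(1) assms(3) _ assms(5)] dirichlet_max_principle[OF this(2) assms(3) _ assms(5)]
  show "u x \<le> v x" "v x \<le> u x" using assms(4) by simp_all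
qed

end

section \<open>Extending eigenfunctions from a cell to its subcells\<close>

text \<open>
  The decimation formula. If the cell has corner values \<open>a\<close>, \<open>b\<close>, \<open>d\<close>, the value at the
  midpoint between \<open>a\<close> and \<open>b\<close> is usually written
  \<open>((4 - c) (a + b) + 2 d) / ((2 - c) (5 - c))\<close>. Using the sum of all three values instead
  of the opposite one makes the symmetry in \<open>i\<close> and \<open>j\<close> evident. The result is the triple of
  corner values of subcell \<open>i\<close>.
\<close>

definition extend :: "real \<Rightarrow> 3 \<Rightarrow> (3 \<Rightarrow> real) \<Rightarrow> 3 \<Rightarrow> real" where
  "extend c i p j = (if j = i then p i
     else (p i + p j) / (5 - c) + 2 * (\<Sum>k\<in>UNIV. p k) / ((2 - c) * (5 - c)))"

lemma extend_same [simp]: "extend c i p i = p i"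
  by (simp add: extend_def)

lemma extend_commute: "i \<noteq> j \<Longrightarrow> extend c i p j = extend c j p i"
  by (simp add: extend_def add.commute)

text \<open>
  With \<open>c < 0\<close> a new value is a combination of old ones with positive coefficients of total
  \<open>2 / (2 - c) < 1\<close>, so the supremum \<open>B\<close> does not grow. The oscillation \<open>D\<close> shrinks by the
  factor \<open>3/5\<close> of the harmonic case \<open>c = 0\<close>, up to an error proportional to \<open>c\<close>. These two
  facts make the iterated extension converge uniformly.
\<close>

lemma extend_bounds:
  fixes p :: "3 \<Rightarrow> real"
  assumes c: "c < 0" and B: "\<And>k. \<bar>p k\<bar> \<le> B" and D: "\<And>j k. \<bar>p j - p k\<bar> \<le> D"
  shows "\<bar>extend c i p j\<bar> \<le> B"
    and "\<bar>extend c i p j - p i\<bar> \<le> 3/5 * D - c/2 * B"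
    and "\<bar>extend c i p j - extend c i p k\<bar> \<le> 3/5 * D - c/2 * B"
proof -
  define d where "d = (2 - c) * (5 - c)"
  have d: "d > 0" using c by (simp add: d_def)
  have pos: "0 \<le> B" "0 \<le> D" using B[of 0] D[of 0 0] by auto
  have triangle: "\<bar>x + 2 * y + z\<bar> \<le> \<bar>x\<bar> + 2 * \<bar>y\<bar> + \<bar>z\<bar>" for x y z :: real
    by linarith
  have cB: "- c * B \<ge> 0" using c pos by (simp add: mult_nonpos_nonneg)
  \<comment> \<open>the formula at a new vertex, with the third vertex of the cell made explicit\<close>
  have third: "\<exists>k. d * extend c i p j = (4 - c) * (p i + p j) + 2 * p k" if ij: "i \<noteq> j" for i j
  proof -
    obtain k where k: "(\<Sum>k\<in>UNIV. p k) = p i + p j + p k"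
      using ij three_cases[of i] three_cases[of j] by (auto simp: sum_three)
    have "extend c i p j = ((2 - c) * (p i + p j) + 2 * (p i + p j + p k)) / d"
      using ij c by (simp add: extend_def k d_def add_divide_distrib)
    then have "d * extend c i p j = (2 - c) * (p i + p j) + 2 * (p i + p j + p k)"
      using d by simp
    then show ?thesis by (intro exI[of _ k]) (simp add: algebra_simps)
  qed
  have bound: "\<bar>extend c i p j\<bar> \<le> B" for j
  proof (cases "i = j")
    case False
    obtain k where k: "d * extend c i p j = (4 - c) * (p i + p j) + 2 * p k" using third[OF False] by blast
    have "\<bar>(4 - c) * (p i + p j) + 2 * p k\<bar> \<le> \<bar>4 - c\<bar> * \<bar>p i + p j\<bar> + 2 * \<bar>p k\<bar>"
      using triangle[of "(4 - c) * (p i + p j)" "p k" 0] by (simp add: abs_mult)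
    also have "\<dots> \<le> (4 - c) * (2 * B) + 2 * B"
      using c B[of i] B[of j] B[of k] by (intro add_mono mult_mono) auto
    also have "\<dots> \<le> d * B"
    proof -
      have "0 \<le> (- c * B) * (5 - c)" using c by (intro mult_nonneg_nonneg cB) auto
      then show ?thesis by (simp add: d_def algebra_simps)
    qed
    finally have "\<bar>d * extend c i p j\<bar> \<le> d * B" unfolding k .
    then have "d * \<bar>extend c i p j\<bar> \<le> d * B" using d by (simp only: abs_mult abs_of_pos)
    then show ?thesis using d by simp
  qed (use B[of i] in simp)
  then show "\<bar>extend c i p j\<bar> \<le> B" .
  have old: "\<bar>extend c i p j - p i\<bar> \<le> 3/5 * D - c/2 * B" for j
  proof (cases "i = j")
    case True
    then show ?thesis using pos cB by simp
  next
    case False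
    obtain k where k: "d * extend c i p j = (4 - c) * (p i + p j) + 2 * p k" using third[OF False] by blast
    have "d * (p i - extend c i p j) = (4 - c) * (p i - p j) + 2 * (p i - p k) + p i * ((- c) * (5 - c))"
      unfolding right_diff_distrib[of d] k by (simp add: d_def algebra_simps)
    moreover have "d * \<bar>p i - extend c i p j\<bar> = \<bar>d * (p i - extend c i p j)\<bar>"
      using d by (simp only: abs_mult abs_of_pos)
    ultimately have "d * \<bar>p i - extend c i p j\<bar> = \<bar>(4 - c) * (p i - p j) + 2 * (p i - p k) + p i * ((- c) * (5 - c))\<bar>"
      by (simp only:)
    also have "\<dots> \<le> \<bar>4 - c\<bar> * \<bar>p i - p j\<bar> + 2 * \<bar>p i - p k\<bar> + \<bar>p i\<bar> * \<bar>(- c) * (5 - c)\<bar>"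
      unfolding abs_mult[of "4 - c", symmetric] abs_mult[of "p i", symmetric] by (rule triangle)
    also have "\<dots> \<le> (4 - c) * D + 2 * D + B * ((- c) * (5 - c))"
      using c D[of i j] D[of i k] B[of i] pos
      by (intro add_mono mult_mono) (auto simp: abs_mult mult_nonpos_nonneg)
    also have "\<dots> \<le> d * (3/5 * D - c/2 * B)"
    proof -
      have "0 \<le> (- c) * D" "0 \<le> c\<^sup>2 * D" "0 \<le> c\<^sup>2 * B" "0 \<le> c\<^sup>2 * (- c * B)"
        using c pos mult_nonneg_nonneg[OF zero_le_power2 cB, of c]
        by (auto intro: mult_nonneg_nonneg mult_nonpos_nonneg)
      moreover have "d * (3/5 * D - c/2 * B) - ((4 - c) * D + 2 * D + B * ((- c) * (5 - c)))
          = 16/5 * ((- c) * D) + 3/5 * (c\<^sup>2 * D) + 5/2 * (c\<^sup>2 * B) + 1/2 * (c\<^sup>2 * (- c * B))"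
        by (simp add: d_def field_simps power2_eq_square)
      ultimately show ?thesis by linarith
    qed
    finally show ?thesis using d by (simp add: abs_minus_commute)
  qed
  then show "\<bar>extend c i p j - p i\<bar> \<le> 3/5 * D - c/2 * B" .
  show "\<bar>extend c i p j - extend c i p k\<bar> \<le> 3/5 * D - c/2 * B"
  proof (cases "j = i \<or> k = i")
    case True
    then show ?thesis using old[of j] old[of k] by (auto simp: abs_minus_commute)
  next
    case False
    then have "extend c i p j - extend c i p k = (p j - p k) / (5 - c)"
      by (simp add: extend_def diff_divide_distrib add_divide_distrib)
    also have "\<bar>\<dots>\<bar> = \<bar>p j - p k\<bar> / (5 - c)" using c by simp
    also have "\<dots> \<le> D / 5" using c D[of j k] pos by (intro frac_le) auto
    also have "\<dots> \<le> 3/5 * D" using pos by simp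
    also have "\<dots> \<le> 3/5 * D - c/2 * B" using cB by (simp add: mult.commute)
    finally show ?thesis .
  qed
qed

text \<open>
  The share of one cell in the eigenvalue equation at its corner \<open>j\<close>: an interior vertex
  lies in two cells, and the equation says that the two fluxes cancel. The term \<open>c * p j\<close> is
  split evenly.
\<close>

definition flux :: "real \<Rightarrow> (3 \<Rightarrow> real) \<Rightarrow> 3 \<Rightarrow> real" where
  "flux c p j = (\<Sum>k\<in>UNIV. p k - p j) + c / 2 * p j"

text \<open>
  The heart of spectral decimation: passing to the subcell at the corner \<open>j\<close> multiplies the
  flux by a factor that does not depend on the cell or on its values. Fluxes that cancel on
  one level therefore cancel on all finer ones.
\<close>

lemma flux_extend:
  assumes "c < 0"
  shows "flux c (extend c j p) j = (6 - c) / ((2 - c) * (5 - c)) * flux (c * (5 - c)) p j"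
proof -
  define s where "s = (\<Sum>k\<in>UNIV. p k)"
  have 1: "(\<Sum>k\<in>UNIV. p k - p j) = s - 3 * p j" by (simp add: s_def sum_subtractf)
  have "(\<Sum>k\<in>UNIV. extend c j p k - p j)
      = (\<Sum>k\<in>UNIV - {j}. (p j + p k) / (5 - c) + 2 * s / ((2 - c) * (5 - c)) - p j)"
    by (subst sum.remove[of UNIV j]) (auto simp: extend_def s_def intro: sum.cong)
  also have "\<dots> = (\<Sum>k\<in>UNIV. (p j + p k) / (5 - c) + 2 * s / ((2 - c) * (5 - c)) - p j)
      - ((p j + p j) / (5 - c) + 2 * s / ((2 - c) * (5 - c)) - p j)"
    by (simp add: sum.remove[of UNIV j])
  also have "\<dots> = (s + p j) / (5 - c) + 4 * s / ((2 - c) * (5 - c)) - 2 * p j"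
    by (simp add: sum_subtractf sum.distrib add_divide_distrib sum_divide_distrib[symmetric] s_def)
  finally have 2: "(\<Sum>k\<in>UNIV. extend c j p k - p j)
      = (s + p j) / (5 - c) + 4 * s / ((2 - c) * (5 - c)) - 2 * p j" .
  have ne: "2 - c \<noteq> 0" "5 - c \<noteq> 0" using assms by auto
  show ?thesis
    unfolding flux_def extend_same 1 2 using ne
    by (simp add: divide_simps) (simp add: algebra_simps power2_eq_square)
qed

text \<open>
  The midpoint values are chosen such that the eigenvalue equation holds at the new
  vertices.
\<close>

lemma flux_junction:
  assumes "c < 0" "i \<noteq> j"
  shows "flux c (extend c i p) j + flux c (extend c j p) i = 0"
proof -
  have ne: "2 - c \<noteq> 0" "5 - c \<noteq> 0" using assms by auto
  show ?thesis
    using three_cases[of i] three_cases[of j] assms(2) ne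
    unfolding flux_def extend_def sum_three
    by (elim disjE) (simp_all add: divide_simps, simp_all add: algebra_simps power2_eq_square)
qed

section \<open>Eigenfunctions on the gasket\<close>

locale decimation = gasket +
  fixes l :: "int \<Rightarrow> real" and lam :: real
  assumes lam_pos: "lam > 0"
    and l_neg: "\<And>n. l n < 0"
    and l_rec: "\<And>n. l (n - 1) = l n * (5 - l n)"
    and l_lim: "((\<lambda>n::int. 3/2 * 5 powi n * l n) \<longlongrightarrow> - lam) at_top"
begin

lemma l_step: "l n = l (n + 1) * (5 - l (n + 1))"
  using l_rec[of "n + 1"] by simp

lemma l_growth: "- l (n + 1) \<le> - l n / 5"
  using l_step[of n] zero_le_square[of "l (n + 1)"] unfolding right_diff_distrib by linarith

lemma l_growth_pow: "- l (n + int k) \<le> - l n / 5 ^ k"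
proof (induction k)
  case (Suc k)
  then show ?case using l_growth[of "n + int k"] by (simp add: add.assoc add.commute[of 1])
qed simp

text \<open>
  The \<open>m\<close>-th approximation extends the corner values \<open>p\<close> through \<open>m\<close> levels and interpolates
  linearly in the cells that result. At a junction, where the choice of the cell is
  ambiguous, both choices give the same value (\<open>approx_cell\<close>).
\<close>

primrec approx :: "nat \<Rightarrow> int \<Rightarrow> (3 \<Rightarrow> real) \<Rightarrow> real^2 \<Rightarrow> real" where
  "approx 0 = (\<lambda>n p x. \<Sum>i\<in>UNIV. p i * bary i x)"
| "approx (Suc m) = (\<lambda>n p x.
     let i = (SOME i. x \<in> F q i ` SG q)
     in approx m (n + 1) (extend (l (n + 1)) i p) (2 *\<^sub>R x - q i))"

lemma approx_Suc:
  assumes "y \<in> SG q"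
  obtains j y' where "y' \<in> SG q" "F q i y = F q j y'"
    "approx (Suc m) n p (F q i y) = approx m (n + 1) (extend (l (n + 1)) j p) y'"
proof -
  define j where "j = (SOME j. F q i y \<in> F q j ` SG q)"
  have "F q i y \<in> F q j ` SG q" unfolding j_def by (rule someI[of _ i]) (use assms in simp)
  then obtain y' where y': "y' \<in> SG q" "F q i y = F q j y'" by auto
  have "2 *\<^sub>R F q j y' - q j = y'" by (simp add: F_def)
  then have "approx (Suc m) n p (F q i y) = approx m (n + 1) (extend (l (n + 1)) j p) y'"
    unfolding y'(2)[symmetric] by (simp add: j_def[symmetric])
  with y' show thesis by (rule that)
qed

text \<open>
  Only the cell \<open>j\<close> contains the corner \<open>q j\<close>, so this value never meets an ambiguous
  choice; the independence of the choice at junctions is then derived from it.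
\<close>

lemma approx_corner: "approx m n p (q j) = p j"
proof (induction m arbitrary: n p)
  case 0
  have "(\<Sum>i\<in>UNIV. p i * bary i (q j)) = (\<Sum>i\<in>UNIV. if i = j then p j else 0)"
    by (rule sum.cong) (auto simp: bary_q)
  then show ?case by simp
next
  case (Suc m)
  obtain i y where y: "y \<in> SG q" "F q j (q j) = F q i y"
    "approx (Suc m) n p (F q j (q j)) = approx m (n + 1) (extend (l (n + 1)) i p) y"
    using approx_Suc[OF q_in_SG] by metis
  have "i = j" "y = q j" using corner_cell[OF y(1)] y(2) F_q by metis+
  then show ?case using y(3) Suc by (simp only: F_q extend_same)
qed

lemma approx_cell:
  assumes "y \<in> SG q"
  shows "approx (Suc m) n p (F q i y) = approx m (n + 1) (extend (l (n + 1)) i p) y"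
proof -
  obtain j y' where y': "y' \<in> SG q" "F q i y = F q j y'"
    "approx (Suc m) n p (F q i y) = approx m (n + 1) (extend (l (n + 1)) j p) y'"
    using approx_Suc[OF assms] by metis
  show ?thesis
  proof (cases "i = j")
    case True
    then show ?thesis using y' by (simp only: F_inj)
  next
    case False
    then have "y = q j" "y' = q i" using cells_meet[OF assms y'(1,2)] by auto
    then show ?thesis using y'(3) False by (simp only: approx_corner extend_commute)
  qed
qed

lemma continuous_on_approx: "continuous_on (SG q) (approx m n p)"
proof (induction m arbitrary: n p)
  case 0
  show ?case by (auto intro!: continuous_intros continuous_on_bary)
next
  case (Suc m)
  have cell: "continuous_on (F q i ` SG q) (approx (Suc m) n p)" for i
  proof -
    have "continuous_on (F q i ` SG q) (\<lambda>x. approx m (n + 1) (extend (l (n + 1)) i p) (2 *\<^sub>R x - q i))"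
      by (rule continuous_on_compose2[OF Suc[of "n + 1" "extend (l (n + 1)) i p"]])
        (auto intro!: continuous_intros simp: F_def)
    moreover have "approx (Suc m) n p x = approx m (n + 1) (extend (l (n + 1)) i p) (2 *\<^sub>R x - q i)"
      if x: "x \<in> F q i ` SG q" for x
    proof -
      obtain y where y: "y \<in> SG q" "x = F q i y" using x by blast
      have "2 *\<^sub>R x - q i = y" using y by (simp add: F_def)
      then show ?thesis using approx_cell[OF y(1)] y(2) by metis
    qed
    ultimately show ?thesis by (simp only: cong: continuous_on_cong)
  qed
  have cl: "closed (F q i ` SG q)" for i
    by (intro compact_imp_closed compact_continuous_image continuous_on_F compact_SG)
  have "continuous_on (\<Union>i. F q i ` SG q) (approx (Suc m) n p)"
    unfolding UN_three by (intro continuous_on_closed_Un closed_Un cl cell)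
  then show ?case unfolding SG_unfold[symmetric] .
qed

text \<open>
  The quantity \<open>D - l n * B\<close> contracts by \<open>3/5\<close> from one level to the next: the error
  \<open>- l (n + 1) / 2 * B\<close> in the oscillation bound is absorbed because \<open>- l\<close> itself shrinks by
  a factor of at least \<open>5\<close>.
\<close>

lemma approx_step_bound:
  assumes "x \<in> SG q" and "\<And>k. \<bar>p k\<bar> \<le> B" "\<And>j k. \<bar>p j - p k\<bar> \<le> D"
  shows "\<bar>approx (Suc m) n p x - approx m n p x\<bar> \<le> (3/5) ^ m * (D - l n * B)"
  using assms
proof (induction m arbitrary: n p x B D)
  case 0
  obtain i y where y: "y \<in> SG q" "x = F q i y" using 0(1) by (rule SG_cases)
  let ?e = "extend (l (n + 1)) i p"
  have B: "0 \<le> B" and D: "0 \<le> D" using 0(2)[of 0] 0(3)[of 0 0] by auto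
  have lB: "- l (n + 1) * B \<le> - l n / 5 * B" using l_growth[of n] B by (rule mult_right_mono)
  have lB': "0 \<le> - l n * B" using B l_neg[of n] by (simp add: mult_nonpos_nonneg)
  \<comment> \<open>linear interpolation on the coarse level gives the mean at the midpoint\<close>
  have half: "\<bar>?e j - (p i + p j) / 2\<bar> \<le> D - l n * B" for j
  proof (cases "j = i")
    case False
    have "\<bar>?e j - p i\<bar> \<le> 3/5 * D - l (n + 1) / 2 * B"
      using extend_bounds(2)[OF l_neg 0(2,3)] .
    moreover have "\<bar>?e j - p j\<bar> \<le> 3/5 * D - l (n + 1) / 2 * B"
      unfolding extend_commute[OF False[symmetric]]
      using extend_bounds(2)[OF l_neg[of "n + 1"] 0(2,3), where i=j and j=i] .
    moreover have "\<bar>e - (a + b) / 2\<bar> \<le> K" if "\<bar>e - a\<bar> \<le> K" "\<bar>e - b\<bar> \<le> K" for e a b K :: real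
      using that unfolding abs_le_iff by (simp add: field_simps)
    ultimately have "\<bar>?e j - (p i + p j) / 2\<bar> \<le> 3/5 * D - l (n + 1) / 2 * B" by blast
    then show ?thesis using lB lB' D by simp
  qed (use D lB' in simp)
  have sum1: "(\<Sum>j\<in>UNIV. bary j y) = 1" by (rule SG_triangle[OF y(1)])
  have "approx (Suc 0) n p x = (\<Sum>j\<in>UNIV. ?e j * bary j y)"
    unfolding y(2) approx_cell[OF y(1)] by simp
  moreover have "approx 0 n p x = (\<Sum>j\<in>UNIV. (p i + p j) / 2 * bary j y)"
  proof -
    have "approx 0 n p x = (\<Sum>j\<in>UNIV. p j * bary j y + (if j = i then p i else 0)) / 2"
      unfolding y(2) by (simp add: bary_F sum_divide_distrib) (auto intro!: sum.cong simp: field_simps)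
    also have "\<dots> = ((\<Sum>j\<in>UNIV. p j * bary j y) + p i * (\<Sum>j\<in>UNIV. bary j y)) / 2"
      unfolding sum1 by (simp add: sum.distrib)
    also have "\<dots> = (\<Sum>j\<in>UNIV. (p i + p j) / 2 * bary j y)"
      by (simp add: sum_distrib_left sum.distrib[symmetric] sum_divide_distrib algebra_simps add_divide_distrib)
    finally show ?thesis .
  qed
  ultimately have "approx (Suc 0) n p x - approx 0 n p x = (\<Sum>j\<in>UNIV. (?e j - (p i + p j) / 2) * bary j y)"
    by (simp only: sum_subtractf[symmetric] left_diff_distrib)
  also have "\<bar>\<dots>\<bar> \<le> (\<Sum>j\<in>UNIV. \<bar>(?e j - (p i + p j) / 2) * bary j y\<bar>)" by (rule sum_abs)
  also have "\<dots> \<le> (\<Sum>j\<in>UNIV. (D - l n * B) * bary j y)"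
    using half SG_triangle(1)[OF y(1)] by (intro sum_mono) (simp add: abs_mult mult_right_mono)
  also have "\<dots> = D - l n * B" using sum1 by (simp add: sum_distrib_left[symmetric])
  finally show ?case by simp
next
  case (Suc m)
  obtain i y where y: "y \<in> SG q" "x = F q i y" using Suc.prems(1) by (rule SG_cases)
  let ?e = "extend (l (n + 1)) i p"
  let ?D = "3/5 * D - l (n + 1) / 2 * B"
  have B: "0 \<le> B" using Suc.prems(2)[of 0] by auto
  have lB: "- l (n + 1) * B \<le> - l n / 5 * B" using l_growth[of n] B by (rule mult_right_mono)
  have lB': "0 \<le> - l n * B" using B l_neg[of n] by (simp add: mult_nonpos_nonneg)
  have "\<bar>approx (Suc (Suc m)) n p x - approx (Suc m) n p x\<bar>
      = \<bar>approx (Suc m) (n + 1) ?e y - approx m (n + 1) ?e y\<bar>"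
    unfolding y(2) approx_cell[OF y(1)] ..
  also have "\<dots> \<le> (3/5) ^ m * (?D - l (n + 1) * B)"
    by (rule Suc.IH[OF y(1)]) (rule extend_bounds[OF l_neg Suc.prems(2,3)])+
  also have "\<dots> \<le> (3/5) ^ m * (3/5 * (D - l n * B))"
    using lB lB' by (intro mult_left_mono) (simp_all add: algebra_simps)
  finally show ?case by (simp only: power_Suc2 mult.assoc)
qed

definition eigfun :: "int \<Rightarrow> (3 \<Rightarrow> real) \<Rightarrow> real^2 \<Rightarrow> real" where
  "eigfun n p x = lim (\<lambda>m. approx m n p x)"

lemma uniform_limit_approx: "uniform_limit (SG q) (\<lambda>m. approx m n p) (eigfun n p) sequentially"
proof -
  define B where "B = Max (range (\<lambda>k. \<bar>p k\<bar>))"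
  have B: "\<bar>p k\<bar> \<le> B" for k unfolding B_def by simp
  have D: "\<bar>p j - p k\<bar> \<le> 2 * B" for j k using B[of j] B[of k] by linarith
  let ?K = "2 * B - l n * B"
  have telescope: "approx 0 n p x + (\<Sum>k<m. approx (Suc k) n p x - approx k n p x) = approx m n p x" for m x
    using sum_lessThan_telescope[of "\<lambda>k. approx k n p x" m] by linarith
  have "uniform_limit (SG q) (\<lambda>m x. \<Sum>k<m. approx (Suc k) n p x - approx k n p x)
      (\<lambda>x. suminf (\<lambda>k. approx (Suc k) n p x - approx k n p x)) sequentially"
  proof (rule Weierstrass_m_test)
    show "norm (approx (Suc m) n p x - approx m n p x) \<le> (3/5) ^ m * ?K" if "x \<in> SG q" for m x
      using approx_step_bound[OF that B D] by simp
    show "summable (\<lambda>m. (3/5) ^ m * ?K)" by (intro summable_mult2 summable_geometric) simp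
  qed
  then have "uniform_limit (SG q) (\<lambda>m x. approx 0 n p x + (\<Sum>k<m. approx (Suc k) n p x - approx k n p x))
      (\<lambda>x. approx 0 n p x + suminf (\<lambda>k. approx (Suc k) n p x - approx k n p x)) sequentially"
    by (intro uniform_limit_add uniform_limit_const)
  then have *: "uniform_limit (SG q) (\<lambda>m. approx m n p)
      (\<lambda>x. approx 0 n p x + suminf (\<lambda>k. approx (Suc k) n p x - approx k n p x)) sequentially"
    unfolding telescope .
  have "eigfun n p x = approx 0 n p x + suminf (\<lambda>k. approx (Suc k) n p x - approx k n p x)"
    if "x \<in> SG q" for x
    unfolding eigfun_def by (rule limI) (rule tendsto_uniform_limitI[OF * that])
  then show ?thesis using * by (simp cong: uniform_limit_cong')
qed

lemma approx_LIMSEQ: "x \<in> SG q \<Longrightarrow> (\<lambda>m. approx m n p x) \<longlonglongrightarrow> eigfun n p x"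
  by (rule tendsto_uniform_limitI[OF uniform_limit_approx])

lemma continuous_on_eigfun: "continuous_on (SG q) (eigfun n p)"
  by (rule uniform_limit_theorem[OF _ uniform_limit_approx]) (auto simp: continuous_on_approx)

lemma eigfun_corner: "eigfun n p (q j) = p j"
  using approx_LIMSEQ[OF q_in_SG, of n p j] by (simp add: approx_corner LIMSEQ_const_iff)

lemma eigfun_cell:
  assumes "y \<in> SG q"
  shows "eigfun n p (F q i y) = eigfun (n + 1) (extend (l (n + 1)) i p) y"
proof -
  have "(\<lambda>m. approx (Suc m) n p (F q i y)) \<longlonglongrightarrow> eigfun n p (F q i y)"
    by (rule LIMSEQ_Suc[OF approx_LIMSEQ[OF F_in_SG[OF assms]]])
  moreover have "(\<lambda>m. approx (Suc m) n p (F q i y)) \<longlonglongrightarrow> eigfun (n + 1) (extend (l (n + 1)) i p) y"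
    unfolding approx_cell[OF assms] by (rule approx_LIMSEQ[OF assms])
  ultimately show ?thesis by (rule LIMSEQ_unique)
qed

lemma laplacian_eigfun_cell:
  assumes "x \<in> SG q"
  shows "discrete_laplacian q m (eigfun n p \<circ> F q i) x
    = discrete_laplacian q m (eigfun (n + 1) (extend (l (n + 1)) i p)) x"
  by (rule discrete_laplacian_cong) (use assms eigfun_cell in auto)

text \<open>
  Along the cells shrinking to the corner \<open>q j\<close> the flux is multiplied by factors that
  depend only on the levels. For the cancellation at junctions it matters only that the
  product \<open>r\<close> is the same for all corners and all values.
\<close>

lemma laplacian_eigfun_corner:
  "\<exists>r. \<forall>p j. discrete_laplacian q m (eigfun n p) (q j) + l (n + int m) / 2 * p j = r * flux (l n) p j"
proof (induction m arbitrary: n)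
  case 0
  show ?case by (intro exI[of _ 1]) (simp add: discrete_laplacian_0 eigfun_corner flux_def)
next
  case (Suc m)
  let ?c = "l (n + 1)"
  obtain r where r: "\<And>p j. discrete_laplacian q m (eigfun (n + 1) p) (q j)
      + l (n + 1 + int m) / 2 * p j = r * flux ?c p j"
    using Suc[of "n + 1"] by blast
  have "discrete_laplacian q (Suc m) (eigfun n p) (q j) + l (n + int (Suc m)) / 2 * p j
      = r * ((6 - ?c) / ((2 - ?c) * (5 - ?c))) * flux (l n) p j" for p j
    using r[of "extend ?c j p" j]
    unfolding discrete_laplacian_corner laplacian_eigfun_cell[OF q_in_SG] extend_same
      flux_extend[OF l_neg] l_step[of n, symmetric]
    by (simp add: add.assoc)
  then show ?case by blast
qed

text \<open>
  A vertex that is interior to a cell inherits the equation from that cell. At a junction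
  the two one-sided fluxes cancelled when the vertex was created (\<open>flux_junction\<close>), and
  since then both have been multiplied by the same factor.
\<close>

lemma laplacian_eigfun:
  assumes "x \<in> V q m - V q 0"
  shows "discrete_laplacian q m (eigfun n p) x = - l (n + int m) * eigfun n p x"
  using assms
proof (induction m arbitrary: n p x)
  case (Suc m)
  let ?c = "l (n + 1)"
  have idx: "n + 1 + int m = n + int (Suc m)" by simp
  from Suc.prems show ?case
  proof (cases rule: V_Suc_cases)
    case (interior i y)
    then have y: "y \<in> SG q" using V_subset_SG by blast
    show ?thesis
      unfolding interior(2) discrete_laplacian_interior[OF interior(1)] laplacian_eigfun_cell[OF y]
        eigfun_cell[OF y] Suc.IH[OF interior(1)] idx ..
  next
    case (junction i j)
    obtain r where r: "\<And>p j. discrete_laplacian q m (eigfun (n + 1) p) (q j)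
        + l (n + 1 + int m) / 2 * p j = r * flux ?c p j"
      using laplacian_eigfun_corner[of m "n + 1"] by blast
    have "discrete_laplacian q (Suc m) (eigfun n p) x
        = r * (flux ?c (extend ?c i p) j + flux ?c (extend ?c j p) i)
          - l (n + 1 + int m) / 2 * (extend ?c i p j + extend ?c j p i)"
      unfolding junction(2) discrete_laplacian_junction[OF junction(1)] laplacian_eigfun_cell[OF q_in_SG]
      using r[of "extend ?c i p" j] r[of "extend ?c j p" i] by (simp add: algebra_simps)
    also have "\<dots> = - l (n + int (Suc m)) * extend ?c i p j"
      unfolding flux_junction[OF l_neg junction(1)] extend_commute[OF junction(1)] idx by simp
    also have "extend ?c i p j = eigfun n p x"
      unfolding junction(2) eigfun_cell[OF q_in_SG] eigfun_corner ..
    finally show ?thesis .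
  qed
qed simp

lemma l_scaled_limit: "(\<lambda>m. 3/2 * 5 ^ m * l (n + int m)) \<longlonglongrightarrow> - (5 powi (- n) * lam)"
proof -
  have "filterlim (\<lambda>m. n + int m) at_top sequentially"
    unfolding filterlim_at_top eventually_sequentially
  proof
    fix Z show "\<exists>N. \<forall>m\<ge>N. Z \<le> n + int m" by (rule exI[of _ "nat (Z - n)"]) linarith
  qed
  from filterlim_compose[OF l_lim this]
  have "(\<lambda>m. 5 powi (- n) * (3/2 * 5 powi (n + int m) * l (n + int m))) \<longlonglongrightarrow> 5 powi (- n) * (- lam)"
    by (rule tendsto_mult_left)
  moreover have "5 powi (- n) * (3/2 * 5 powi (n + int m) * l (n + int m)) = 3/2 * 5 ^ m * l (n + int m)" for m
    by (simp add: power_int_add power_int_minus)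
  ultimately show ?thesis by (simp only: mult_minus_right)
qed

text \<open>
  The graph equation is exact, so the error is the distance of \<open>3/2 5 ^ m l (n + m)\<close> from
  its limit times the bounded function itself, hence uniformly small.
\<close>

lemma has_laplacian_eigfun: "has_laplacian q (eigfun n p) (\<lambda>x. 5 powi (- n) * lam * eigfun n p x)"
  unfolding has_laplacian_def
proof (intro conjI allI impI)
  fix e :: real assume e: "e > 0"
  let ?mu = "5 powi (- n) * lam"
  have "compact (eigfun n p ` SG q)" by (rule compact_continuous_image[OF continuous_on_eigfun compact_SG])
  then obtain B where B: "B > 0" "\<And>x. x \<in> SG q \<Longrightarrow> \<bar>eigfun n p x\<bar> \<le> B"
    using bounded_pos[of "eigfun n p ` SG q"] compact_imp_bounded by auto
  obtain M where M: "\<And>m. m \<ge> M \<Longrightarrow> \<bar>3/2 * 5 ^ m * l (n + int m) - - ?mu\<bar> < e / B"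
    using LIMSEQ_D[OF l_scaled_limit, of "e / B" n] e B(1) by auto
  have "\<bar>3/2 * 5^m * discrete_laplacian q m (eigfun n p) x - ?mu * eigfun n p x\<bar> < e"
    if m: "m \<ge> M" and x: "x \<in> V q m - V q 0" for m x
  proof -
    have "3/2 * 5^m * discrete_laplacian q m (eigfun n p) x - ?mu * eigfun n p x
        = - (3/2 * 5 ^ m * l (n + int m) - - ?mu) * eigfun n p x"
      unfolding laplacian_eigfun[OF x] by (simp add: algebra_simps)
    also have "\<bar>\<dots>\<bar> \<le> \<bar>3/2 * 5 ^ m * l (n + int m) - - ?mu\<bar> * B"
      unfolding abs_mult abs_minus_cancel using B(2)[of x] x V_subset_SG by (intro mult_left_mono) auto
    also have "\<dots> < e / B * B" using M[OF m] B(1) by (rule mult_strict_right_mono)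
    finally show ?thesis using B(1) by simp
  qed
  then show "\<exists>M. \<forall>m\<ge>M. \<forall>x\<in>V q m - V q 0.
      \<bar>3/2 * 5^m * discrete_laplacian q m (eigfun n p) x - ?mu * eigfun n p x\<bar> < e" by blast
qed (auto intro!: continuous_intros continuous_on_eigfun)

end

section \<open>The infinite blow-up and its reflection\<close>

context gasket
begin

text \<open>
  All integer powers of the contraction are homotheties with centre \<open>q 0\<close>, which makes the
  algebra of positive and negative powers uniform.
\<close>

lemma F0_powi_eq: "F0_powi q n z = q 0 + (2 powi (- n)) *\<^sub>R (z - q 0)"
proof -
  have inv: "inv (F q 0) = (\<lambda>z. 2 *\<^sub>R z - q 0)"
    by (rule inv_equality) (simp_all add: F_def)
  have pos: "(F q 0 ^^ k) z = q 0 + (1/2) ^ k *\<^sub>R (z - q 0)" for k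
  proof (induction k)
    case (Suc k)
    have "F q 0 (q 0 + v) = q 0 + (1/2) *\<^sub>R v" for v
      by (simp add: F_def algebra_simps flip: scaleR_2)
    then show ?case using Suc by simp
  qed simp
  have neg: "(inv (F q 0) ^^ k) z = q 0 + 2 ^ k *\<^sub>R (z - q 0)" for k
  proof (induction k)
    case (Suc k)
    have "2 *\<^sub>R (q 0 + v) - q 0 = q 0 + 2 *\<^sub>R v" for v
      by (simp add: algebra_simps scaleR_2)
    then show ?case using Suc by (simp add: inv)
  qed simp
  show ?thesis
  proof (cases "n \<ge> 0")
    case True
    then obtain k where "n = int k" using nonneg_int_cases by blast
    then show ?thesis using pos[of k] by (simp add: F0_powi_def power_int_minus power_one_over inverse_eq_divide)
  next
    case False
    then obtain k where "n = - int k" by (metis int_cases2 linear neg_0_le_iff_le of_nat_0_le_iff)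
    then show ?thesis using False neg[of k] by (simp add: F0_powi_def)
  qed
qed

lemma F0_powi_add: "F0_powi q m (F0_powi q n z) = F0_powi q (m + n) z"
  by (simp add: F0_powi_eq power_int_add[symmetric] add.commute)

lemma F0_powi_0: "F0_powi q 0 z = z"
  by (simp add: F0_powi_eq)

lemma F0_powi_corner: "F0_powi q n (q 0) = q 0"
  by (simp add: F0_powi_eq)

lemma F0_powi_Suc: "F0_powi q (int (Suc k)) z = F q 0 (F0_powi q (int k) z)"
  by (simp add: F0_powi_def nat_add_distrib)

lemma F0_powi_in_SG: "z \<in> SG q \<Longrightarrow> F0_powi q (int k) z \<in> SG q"
  by (induction k) (simp_all only: F0_powi_Suc F_in_SG of_nat_0 F0_powi_0)

lemma F0_powi_in_SG_mono:
  assumes "F0_powi q (int N) z \<in> SG q" "N \<le> M"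
  shows "F0_powi q (int M) z \<in> SG q"
  using F0_powi_in_SG[OF assms(1), of "M - N"] assms(2) by (simp add: F0_powi_add of_nat_diff)

lemma SG_inf_iff: "x \<in> SG_inf q \<longleftrightarrow> (\<exists>N. F0_powi q (int N) x \<in> SG q)"
proof
  assume "x \<in> SG_inf q"
  then show "\<exists>N. F0_powi q (int N) x \<in> SG q"
    unfolding SG_inf_def
  proof safe
    fix N y assume "y \<in> SG q"
    then have "F0_powi q (int N) (F0_powi q (- int N) y) \<in> SG q" by (simp add: F0_powi_add F0_powi_0)
    then show "\<exists>M. F0_powi q (int M) (F0_powi q (- int N) y) \<in> SG q" ..
  qed
next
  assume "\<exists>N. F0_powi q (int N) x \<in> SG q"
  then obtain N where "F0_powi q (int N) x \<in> SG q" ..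
  then have "F0_powi q (int (Suc N)) x \<in> SG q" by (rule F0_powi_in_SG_mono) simp
  moreover have "x = F0_powi q (- int (Suc N)) (F0_powi q (int (Suc N)) x)"
    by (simp only: F0_powi_add) (simp add: F0_powi_0)
  ultimately show "x \<in> SG_inf q" unfolding SG_inf_def by (intro UN_I[of "Suc N"]) auto
qed

lemma F0_powi_q_in_SG:
  assumes "- n \<le> int N" shows "F0_powi q (int N) (F0_powi q n (q j)) \<in> SG q"
proof -
  have "int N + n = int (nat (int N + n))" using assms by simp
  then show ?thesis using F0_powi_in_SG[OF q_in_SG, of "nat (int N + n)" j] by (simp only: F0_powi_add)
qed

lemma F0_powi_q_in_SG_inf: "F0_powi q n (q j) \<in> SG_inf q"
  unfolding SG_inf_iff by (rule exI[of _ "nat (- n)"]) (rule F0_powi_q_in_SG, simp)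

text \<open>
  The action of the reflection on the indices of the corners.
\<close>

definition swap :: "3 \<Rightarrow> 3" where
  "swap i = (if i = 1 then 2 else if i = 2 then 1 else i)"

lemma swap_simps [simp]: "swap 0 = 0" "swap 1 = 2" "swap 2 = 1" "swap i = swap j \<longleftrightarrow> i = j"
  by (auto simp: swap_def)

lemma rho0_q: "rho0 q (q i) = q (swap i)"
proof -
  have "dist (q 1) (q 0) = side" "dist (q 2) (q 0) = side" "dist (q 1) (q 2) = side" "dist (q 2) (q 1) = side"
    "dist (q 0) (q 1) = side" "dist (q 0) (q 2) = side"
    by (rule dist_q, simp)+
  note d = this
  have e1: "(q 1 - q 0) \<bullet> (q 1 - q 2) = side\<^sup>2 / 2" using d by (simp add: inner_of_dist)
  have "(q 2 - q 0) \<bullet> (q 2 - q 1) = side\<^sup>2 / 2" using d by (simp add: inner_of_dist)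
  then have e2: "(q 2 - q 0) \<bullet> (q 1 - q 2) = - (side\<^sup>2 / 2)" by (simp add: inner_diff_right)
  have e3: "(q 1 - q 2) \<bullet> (q 1 - q 2) = side\<^sup>2" using d by (simp add: inner_of_dist)
  have "rho0 q (q 0) = q 0" "rho0 q (q 1) = q 2" "rho0 q (q 2) = q 1"
    unfolding rho0_def e1 e2 e3 using side_pos by simp_all
  then show ?thesis using three_cases[of i] by auto
qed

lemma rho0_F: "rho0 q (F q i y) = F q (swap i) (rho0 q y)"
proof -
  have mid: "rho0 q ((1/2) *\<^sub>R (x + y)) = (1/2) *\<^sub>R (rho0 q x + rho0 q y)" for x y
  proof -
    have "(1/2) *\<^sub>R (x + y) - q 0 = (1/2) *\<^sub>R ((x - q 0) + (y - q 0))"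
      by (simp add: algebra_simps flip: scaleR_2)
    then have "((1/2) *\<^sub>R (x + y) - q 0) \<bullet> (q 1 - q 2)
        = ((x - q 0) \<bullet> (q 1 - q 2) + (y - q 0) \<bullet> (q 1 - q 2)) / 2"
      by (simp only: inner_scaleR_left inner_add_left)
    moreover have "(1/2) *\<^sub>R (x + y) - (2 * ((a + b) / 2) / k) *\<^sub>R e
        = (1/2) *\<^sub>R ((x - (2 * a / k) *\<^sub>R e) + (y - (2 * b / k) *\<^sub>R e))" for a b k and e :: "real^2"
      by (simp add: algebra_simps add_divide_distrib)
    ultimately show ?thesis unfolding rho0_def by (simp only:)
  qed
  show ?thesis unfolding F_def mid rho0_q ..
qed

lemma rho0_F0_powi: "rho0 q (F0_powi q n z) = F0_powi q n (rho0 q z)"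
  by (simp add: F0_powi_eq rho0_def algebra_simps)

lemma continuous_on_rho0: "continuous_on S (rho0 q)"
  unfolding rho0_def divide_inverse by (intro continuous_intros)

lemma rho0_Vstar: "x \<in> Vstar \<Longrightarrow> rho0 q x \<in> Vstar"
proof (induction rule: Vstar_invariant_induct)
  case (corner j)
  then show ?case unfolding rho0_q Vstar_def using q_in_V[of "swap j" 0] by blast
next
  case (cell i y)
  have "F q (swap i) (rho0 q y) \<in> (\<Union>i. F q i ` Vstar)" using cell by blast
  then show ?case unfolding rho0_F Vstar_eq[symmetric] .
qed

lemma rho0_SG: "x \<in> SG q \<Longrightarrow> rho0 q x \<in> SG q"
proof -
  have "rho0 q ` closure Vstar \<subseteq> closure Vstar"
    by (rule image_closure_subset[OF continuous_on_rho0 closed_closure]) (use rho0_Vstar closure_subset in blast)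
  then show "x \<in> SG q \<Longrightarrow> rho0 q x \<in> SG q" unfolding SG_eq_closure by blast
qed

end

lemma extend_linear:
  "extend c i (\<lambda>j. a * p j + b * r j) k = a * extend c i p k + b * extend c i r k"
proof -
  have "(\<Sum>k\<in>UNIV. a * p k + b * r k) = a * (\<Sum>k\<in>UNIV. p k) + b * (\<Sum>k\<in>UNIV. r k)"
    by (simp add: sum.distrib sum_distrib_left)
  then show ?thesis by (simp add: extend_def algebra_simps add_divide_distrib)
qed

context decimation
begin

lemma extend_swap: "extend c (swap i) p (swap j) = extend c i (p \<circ> swap) j"
  by (simp add: extend_def sum_three add_ac)

text \<open>
  Both sides are continuous, so it suffices to compare them at vertices, where the
  reflection only permutes the cells.
\<close>

lemma eigfun_reflect:
  assumes "x \<in> SG q"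
  shows "eigfun n p (rho0 q x) = eigfun n (p \<circ> swap) x"
proof -
  have V: "eigfun n p (rho0 q x) = eigfun n (p \<circ> swap) x" if "x \<in> Vstar" for x n p
    using that
  proof (induction arbitrary: n p rule: Vstar_invariant_induct)
    case (corner j)
    then show ?case by (simp add: rho0_q eigfun_corner)
  next
    case (cell i y)
    have y: "y \<in> SG q" using cell Vstar_subset_SG by blast
    have "extend (l (n + 1)) (swap i) p \<circ> swap = extend (l (n + 1)) i (p \<circ> swap)"
      by (rule ext) (simp add: extend_swap)
    then show ?case
      unfolding rho0_F eigfun_cell[OF rho0_SG[OF y]] eigfun_cell[OF y] by (simp only: cell.IH)
  qed
  have c: "continuous_on (SG q) (\<lambda>x. eigfun n p (rho0 q x))"
    by (rule continuous_on_compose2[OF continuous_on_eigfun continuous_on_rho0]) (use rho0_SG in auto)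
  show ?thesis
    by (intro antisym SG_continuous_extend_le[OF c continuous_on_eigfun _ assms]
        SG_continuous_extend_le[OF continuous_on_eigfun c _ assms]) (simp_all add: V)
qed

lemma eigfun_minus:
  assumes "x \<in> SG q"
  shows "eigfun n (\<lambda>j. - p j) x = - eigfun n p x"
proof -
  have e: "extend c i (\<lambda>j. - p j) = (\<lambda>j. - extend c i p j)" for c i p
    using extend_linear[of c i "-1" p 0 p] by (simp add: fun_eq_iff)
  have "approx m n (\<lambda>j. - p j) x = - approx m n p x" for m n p x
    by (induction m arbitrary: n p x) (simp_all add: e sum_negf Let_def)
  then have "(\<lambda>m. - approx m n p x) \<longlonglongrightarrow> eigfun n (\<lambda>j. - p j) x"
    using approx_LIMSEQ[OF assms, of n "\<lambda>j. - p j"] by simp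
  with tendsto_minus[OF approx_LIMSEQ[OF assms, of n p]] show ?thesis using LIMSEQ_unique by blast
qed

section \<open>Solutions on the blow-up\<close>

text \<open>
  \<open>P n\<close> are the prescribed values at the corners of \<open>F\<^sub>0\<^sup>n(SG)\<close>, and the cell of scale
  \<open>n + 1\<close> is the subcell at \<open>q 0\<close> of the cell of scale \<open>n\<close>.
\<close>

definition compatible :: "(int \<Rightarrow> 3 \<Rightarrow> real) \<Rightarrow> bool" where
  "compatible P \<longleftrightarrow> (\<forall>n. extend (l (n + 1)) 0 (P n) = P (n + 1))"

lemma compatible_linear:
  assumes "compatible P" "compatible R"
  shows "compatible (\<lambda>n j. a * P n j + b * R n j)"
  using assms unfolding compatible_def fun_eq_iff extend_linear by simp

lemma eigfun_iterate:
  assumes "compatible P" "y \<in> SG q"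
  shows "eigfun n (P n) (F0_powi q (int k) y) = eigfun (n + int k) (P (n + int k)) y"
proof (induction k arbitrary: n)
  case (Suc k)
  have "extend (l (n + 1)) 0 (P n) = P (n + 1)" using assms(1) by (simp add: compatible_def)
  moreover have "n + 1 + int k = n + int (Suc k)" by simp
  ultimately show ?case
    unfolding F0_powi_Suc eigfun_cell[OF F0_powi_in_SG[OF assms(2)]] using Suc[of "n + 1"] by (simp only:)
qed (simp add: F0_powi_0)

text \<open>
  Every point of the blow-up is contracted into the gasket by some power of the contraction
  at \<open>q 0\<close>; for compatible values all such powers lead to the same value (\<open>glue_eq\<close>).
  Outside the blow-up the function is undefined, as required of a solution.
\<close>

definition glue :: "(int \<Rightarrow> 3 \<Rightarrow> real) \<Rightarrow> real^2 \<Rightarrow> real" where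
  "glue P x = (if x \<in> SG_inf q then
     (let N = (SOME N. F0_powi q (int N) x \<in> SG q)
      in eigfun (- int N) (P (- int N)) (F0_powi q (int N) x)) else undefined)"

lemma glue_eq:
  assumes P: "compatible P" and N: "F0_powi q (int N) x \<in> SG q"
  shows "glue P x = eigfun (- int N) (P (- int N)) (F0_powi q (int N) x)"
proof -
  let ?h = "\<lambda>N. eigfun (- int N) (P (- int N)) (F0_powi q (int N) x)"
  have le: "?h M = ?h N" if "F0_powi q (int N) x \<in> SG q" "N \<le> M" for M N
  proof -
    have "F0_powi q (int M) x = F0_powi q (int (M - N)) (F0_powi q (int N) x)"
      using that(2) by (simp add: F0_powi_add of_nat_diff)
    then show ?thesis
      using eigfun_iterate[OF P that(1), of "- int M" "M - N"] that(2) by (simp add: of_nat_diff)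
  qed
  define M where "M = (SOME N. F0_powi q (int N) x \<in> SG q)"
  have M: "F0_powi q (int M) x \<in> SG q" unfolding M_def by (rule someI[of _ N]) (rule N)
  have "glue P x = ?h M" using N SG_inf_iff unfolding glue_def M_def[symmetric] by auto
  also have "\<dots> = ?h N" using le[OF M, of N] le[OF N, of M] by (cases "N \<le> M") auto
  finally show ?thesis .
qed

lemma glue_blowup:
  assumes "compatible P" "y \<in> SG q"
  shows "glue P (F0_powi q (- int N) y) = eigfun (- int N) (P (- int N)) y"
  using glue_eq[OF assms(1), of N "F0_powi q (- int N) y"] assms(2) by (simp add: F0_powi_add F0_powi_0)

lemma glue_corner:
  assumes "compatible P"
  shows "glue P (F0_powi q n (q j)) = P n j"
proof -
  define N where "N = nat (- n)"
  define k where "k = nat n"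
  have k: "int N + n = int k" by (simp add: N_def k_def)
  have "glue P (F0_powi q n (q j)) = eigfun (- int N) (P (- int N)) (F0_powi q (int k) (q j))"
    using glue_eq[OF assms F0_powi_q_in_SG, of n N j] by (simp add: F0_powi_add k) (simp add: N_def)
  also have "\<dots> = P (- int N + int k) j"
    by (simp only: eigfun_iterate[OF assms q_in_SG] eigfun_corner)
  also have "- int N + int k = n" using k by simp
  finally show ?thesis .
qed

lemma solution_glue:
  assumes P: "compatible P"
  shows "solution q lam (glue P)"
  unfolding solution_def has_laplacian_inf_def
proof (intro conjI allI)
  show "glue P \<in> extensional (SG_inf q)" by (auto simp: extensional_def glue_def)
  fix n :: nat
  show "has_laplacian q (glue P \<circ> F0_powi q (- int n)) (\<lambda>x. 5 ^ n * (lam * glue P (F0_powi q (- int n) x)))"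
    by (rule has_laplacian_cong[OF has_laplacian_eigfun[of "- int n" "P (- int n)"]])
      (simp_all add: glue_blowup[OF P])
qed

lemma glue_reflect:
  assumes "compatible P" "x \<in> SG_inf q"
  obtains N y where "y \<in> SG q" "glue P x = eigfun (- int N) (P (- int N)) y"
    "glue P (rho0 q x) = eigfun (- int N) (P (- int N) \<circ> swap) y"
proof -
  obtain N where N: "F0_powi q (int N) x \<in> SG q" using assms(2) SG_inf_iff by blast
  have "F0_powi q (int N) (rho0 q x) \<in> SG q" using rho0_SG[OF N] by (simp only: rho0_F0_powi)
  from glue_eq[OF assms(1) this] glue_eq[OF assms(1) N] show thesis
    by (intro that[OF N, of N]) (simp_all only: rho0_F0_powi[symmetric] eigfun_reflect[OF N])
qed

lemma even_glue:
  assumes "compatible P" "\<And>n. P n 1 = P n 2"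
  shows "even_inf q (glue P)"
  unfolding even_inf_def
proof
  fix x assume x: "x \<in> SG_inf q"
  have "P n (swap j) = P n j" for n j using assms(2)[of n] by (auto simp: swap_def)
  then have "P n \<circ> swap = P n" for n by (simp add: fun_eq_iff)
  then show "glue P (rho0 q x) = glue P x" using glue_reflect[OF assms(1) x] by metis
qed

lemma odd_glue:
  assumes "compatible P" "\<And>n. P n 0 = 0" "\<And>n. P n 2 = - P n 1"
  shows "odd_inf q (glue P)"
  unfolding odd_inf_def
proof
  fix x assume x: "x \<in> SG_inf q"
  have "P n (swap j) = - P n j" for n j
    using assms(2,3)[of n] three_cases[of j] by (auto simp: swap_def)
  then have "P n \<circ> swap = (\<lambda>j. - P n j)" for n by (simp add: fun_eq_iff)
  then show "glue P (rho0 q x) = - glue P x" using glue_reflect[OF assms(1) x] eigfun_minus by metis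
qed

text \<open>
  Rescaled to the gasket, both functions solve the same eigenvalue equation with a positive
  constant, and they agree at the three corners.
\<close>

lemma solution_eq_glue:
  assumes u: "solution q lam u" and P: "compatible P"
    and bd: "\<And>j. u (F0_powi q (- int N) (q j)) = P (- int N) j"
    and x: "F0_powi q (int N) x \<in> SG q"
  shows "u x = glue P x"
proof -
  let ?c = "5 powi (int N) * lam"
  have "has_laplacian q (u \<circ> F0_powi q (- int N)) (\<lambda>x. ?c * (u \<circ> F0_powi q (- int N)) x)"
    using u unfolding solution_def has_laplacian_inf_def by (simp add: mult.assoc)
  moreover have "has_laplacian q (eigfun (- int N) (P (- int N))) (\<lambda>x. ?c * eigfun (- int N) (P (- int N)) x)"
    using has_laplacian_eigfun[of "- int N" "P (- int N)"] by simp
  moreover have "?c > 0" using lam_pos by simp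
  ultimately have "(u \<circ> F0_powi q (- int N)) (F0_powi q (int N) x)
      = eigfun (- int N) (P (- int N)) (F0_powi q (int N) x)"
    by (rule dirichlet_unique) (simp_all add: bd eigfun_corner x)
  then show ?thesis using glue_eq[OF P x] by (simp add: F0_powi_add F0_powi_0)
qed

lemma funpow_F: "(F q 0 ^^ m) z = F0_powi q (int m) z"
  by (simp add: F0_powi_def)

section \<open>Uniqueness of the symmetric solutions\<close>

text \<open>
  On the cell of scale \<open>- N\<close> the even solution \<open>u\<close> has corner values \<open>a\<close>, \<open>v\<close>, \<open>v\<close>, and
  since \<open>S\<close> does not vanish at \<open>x (- N)\<close>, these are the values of \<open>a C + b S\<close> for some \<open>b\<close>.
  So \<open>u\<close> equals this combination on the whole cell. Its normal derivative is \<open>b k\<close>, which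
  leaves \<open>b = d / k\<close> for every \<open>N\<close>.
\<close>

lemma even_solution_unique:
  assumes C: "compatible C" "\<And>n. C n 0 = 1" "\<And>n. C n 1 = C n 2"
      "(\<lambda>m. (5/3) ^ m * (2 - 2 * C (int m) 1)) \<longlonglongrightarrow> 0"
    and S: "compatible S" "\<And>n. S n 0 = 0" "\<And>n. S n 1 = S n 2" "\<And>n. S n 1 \<noteq> 0"
      "(\<lambda>m. (5/3) ^ m * (- 2 * S (int m) 1)) \<longlonglongrightarrow> k" "k \<noteq> 0"
    and u: "solution q lam u" "even_inf q u" "u (q 0) = a" "has_normal_deriv q u d"
  shows "u = glue (\<lambda>n j. a * C n j + d / k * S n j)"
proof -
  let ?G = "\<lambda>b. glue (\<lambda>n j. a * C n j + b * S n j)"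
  have loc: "\<exists>b. \<forall>x. F0_powi q (int N) x \<in> SG q \<longrightarrow> u x = ?G b x" for N
  proof -
    define b where "b = (u (F0_powi q (- int N) (q 1)) - a * C (- int N) 1) / S (- int N) 1"
    have "u (F0_powi q (- int N) (q 2)) = u (F0_powi q (- int N) (q 1))"
      using u(2) F0_powi_q_in_SG_inf[of "- int N" 1] rho0_q[of 1]
      by (auto simp: even_inf_def rho0_F0_powi)
    then have "u (F0_powi q (- int N) (q j)) = a * C (- int N) j + b * S (- int N) j" for j
      using three_cases[of j] C(2) S(2) u(3) S(4) C(3)[symmetric] S(3)[symmetric]
      by (auto simp: b_def F0_powi_corner)
    then show ?thesis
      using solution_eq_glue[OF u(1) compatible_linear[OF C(1) S(1)], of N a b] by blast
  qed
  \<comment> \<open>the cell contains all the points at which the normal derivative evaluates \<open>u\<close>\<close>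
  have coeff: "b = d / k" if b: "\<forall>x. F0_powi q (int N) x \<in> SG q \<longrightarrow> u x = ?G b x" for N b
  proof -
    have val: "u ((F q 0 ^^ m) (q j)) = a * C (int m) j + b * S (int m) j" for m j
      using b F0_powi_q_in_SG[of "int m" N j] glue_corner[OF compatible_linear[OF C(1) S(1)]]
      by (simp add: funpow_F)
    have "(\<lambda>m. a * ((5/3) ^ m * (2 - 2 * C (int m) 1)) + b * ((5/3) ^ m * (- 2 * S (int m) 1)))
        \<longlonglongrightarrow> a * 0 + b * k"
      by (intro tendsto_add tendsto_mult_left C S)
    moreover have "(5/3) ^ m * (2 * u (q 0) - u ((F q 0 ^^ m) (q 1)) - u ((F q 0 ^^ m) (q 2)))
        = a * ((5/3) ^ m * (2 - 2 * C (int m) 1)) + b * ((5/3) ^ m * (- 2 * S (int m) 1))" for m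
      unfolding val C(3)[symmetric] S(3)[symmetric] u(3) by (simp add: algebra_simps)
    ultimately have "has_normal_deriv q u (a * 0 + b * k)"
      unfolding has_normal_deriv_def by (simp only:)
    with u(4) have "d = a * 0 + b * k" unfolding has_normal_deriv_def by (rule LIMSEQ_unique)
    then show ?thesis using S(6) by simp
  qed
  show ?thesis
  proof
    fix x
    show "u x = ?G (d / k) x"
    proof (cases "x \<in> SG_inf q")
      case True
      then obtain N where N: "F0_powi q (int N) x \<in> SG q" using SG_inf_iff by blast
      obtain b where b: "\<forall>x. F0_powi q (int N) x \<in> SG q \<longrightarrow> u x = ?G b x" using loc by blast
      from coeff[OF b] b N show ?thesis by blast
    next
      case False
      then show ?thesis using u(1) by (auto simp: solution_def extensional_def glue_def)
    qed
  qed
qed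

text \<open>
  An odd solution vanishes at \<open>q 0\<close> and has opposite values at the two other corners of a
  cell, so there it is a multiple of the odd solution \<open>Q\<close>; the tangential derivative fixes
  the multiple.
\<close>

lemma odd_solution_unique:
  assumes Q: "compatible Q" "\<And>n. Q n 0 = 0" "\<And>n. Q n 2 = - Q n 1" "\<And>n. Q n 1 \<noteq> 0"
      "(\<lambda>m. 5 ^ m * (2 * Q (int m) 1)) \<longlonglongrightarrow> 1"
    and u: "solution q lam u" "odd_inf q u" "has_tangential_deriv q u 1"
  shows "u = glue Q"
proof
  fix x
  show "u x = glue Q x"
  proof (cases "x \<in> SG_inf q")
    case True
    then obtain N where N: "F0_powi q (int N) x \<in> SG q" using SG_inf_iff by blast
    define b where "b = u (F0_powi q (- int N) (q 1)) / Q (- int N) 1"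
    \<comment> \<open>a multiple written as a combination of two families, to which \<open>compatible_linear\<close> applies\<close>
    let ?P = "\<lambda>n j. b * Q n j + 0 * Q n j"
    have P: "compatible ?P" by (rule compatible_linear[OF Q(1) Q(1)])
    have odd: "u (F0_powi q n (q (swap j))) = - u (F0_powi q n (q j))" for n j
      using u(2) F0_powi_q_in_SG_inf[of n j] by (auto simp: odd_inf_def rho0_F0_powi rho0_q)
    have "u (F0_powi q (- int N) (q j)) = ?P (- int N) j" for j
      using three_cases[of j] odd[of "- int N" 0] odd[of "- int N" 1] Q(2-4)
      by (auto simp: b_def F0_powi_corner)
    then have eq: "u x = glue ?P x" if "F0_powi q (int N) x \<in> SG q" for x
      using solution_eq_glue[OF u(1) P _ that] by blast
    have "u ((F q 0 ^^ m) (q j)) = ?P (int m) j" for m j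
      using eq F0_powi_q_in_SG[of "int m" N j] glue_corner[OF P] by (simp add: funpow_F)
    then have "5 ^ m * (u ((F q 0 ^^ m) (q 1)) - u ((F q 0 ^^ m) (q 2))) = b * (5 ^ m * (2 * Q (int m) 1))" for m
      by (simp add: Q(3))
    with tendsto_mult_left[OF Q(5), of b] have "has_tangential_deriv q u (b * 1)"
      unfolding has_tangential_deriv_def by (simp only:)
    with u(3) have "b * 1 = 1" unfolding has_tangential_deriv_def by (rule LIMSEQ_unique[rotated])
    then show ?thesis using eq[OF N] by simp
  next
    case False
    then show ?thesis using u(1) by (auto simp: solution_def extensional_def glue_def)
  qed
qed

section \<open>The values along the ray\<close>

text \<open>
  For even values only the value at \<open>x n\<close> is free, and compatibility becomes a scalar
  recursion.
\<close>

lemma compatible_even: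
  assumes "\<And>n. P n 1 = P n 2" "\<And>n. P n 0 = a"
    and "\<And>n. P (n + 1) 1 = (a + P n 1) / (5 - l (n + 1))
      + 2 * (a + 2 * P n 1) / ((2 - l (n + 1)) * (5 - l (n + 1)))"
  shows "compatible P"
  unfolding compatible_def fun_eq_iff
proof (intro allI)
  fix n j show "extend (l (n + 1)) 0 (P n) j = P (n + 1) j"
  proof (cases "j = 0")
    case True
    then show ?thesis by (simp add: assms(2))
  next
    case False
    then have "P k j = P k 1" for k using three_cases[of j] assms(1) by auto
    moreover have "(\<Sum>k\<in>UNIV. P n k) = a + 2 * P n 1"
      unfolding sum_three assms(2) assms(1)[symmetric] by simp
    ultimately show ?thesis using False by (simp only: extend_def assms(2,3) if_False)
  qed
qed

text \<open>
  The value \<open>1 - l n / 4\<close> is what the eigenvalue equation at \<open>q 0\<close> would demand if four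
  neighbours with equal values were present, that is, if two copies of the even function
  were joined at \<open>q 0\<close>. This is the discrete form of a vanishing normal derivative.
\<close>

definition Cval :: "int \<Rightarrow> 3 \<Rightarrow> real" where
  "Cval n j = (if j = 0 then 1 else 1 - l n / 4)"

lemma compatible_Cval: "compatible Cval"
proof (rule compatible_even)
  fix n
  have "2 - l (n + 1) \<noteq> 0" "5 - l (n + 1) \<noteq> 0" using l_neg[of "n + 1"] by auto
  then show "Cval (n + 1) 1 = (1 + Cval n 1) / (5 - l (n + 1))
      + 2 * (1 + 2 * Cval n 1) / ((2 - l (n + 1)) * (5 - l (n + 1)))"
    unfolding Cval_def l_step[of n] by (simp add: divide_simps) (simp add: algebra_simps)
qed (simp_all add: Cval_def)

lemma l_scaled_LIMSEQ: "(\<lambda>m. 5 ^ m * l (int m)) \<longlonglongrightarrow> - (2/3 * lam)"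
  using tendsto_mult_left[OF l_scaled_limit[of 0], of "2/3"] by (simp add: mult.commute)

lemma Cval_normal: "(\<lambda>m. (5/3) ^ m * (2 - 2 * Cval (int m) 1)) \<longlonglongrightarrow> 0"
proof -
  have "(\<lambda>m. (1/3) ^ m * (5 ^ m * l (int m)) / 2) \<longlonglongrightarrow> 0 * (- (2/3 * lam)) / 2"
    by (intro tendsto_intros l_scaled_LIMSEQ LIMSEQ_realpow_zero) auto
  then show ?thesis by (simp add: Cval_def power_divide)
qed

definition factor :: "int \<Rightarrow> real" where "factor n = 1 + 4 / (2 - l n)"

definition tail_prod :: "int \<Rightarrow> real" where "tail_prod n = (\<Prod>k. factor (n - int k))"

text \<open>
  Going up in scale, \<open>- l\<close> grows at least by the factor \<open>5\<close> in each step; hence the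
  geometric bound.
\<close>

lemma factor_bounds: "0 \<le> factor (n - int k) - 1" "factor (n - int k) - 1 \<le> 4 / - l n * (1/5) ^ k"
proof -
  have "- l n \<le> - l (n - int k) / 5 ^ k" using l_growth_pow[of "n - int k" k] by simp
  then have *: "- l n * 5 ^ k \<le> 2 - l (n - int k)" by (simp add: field_simps)
  have "4 / (2 - l (n - int k)) \<le> 4 / (- l n * 5 ^ k)"
    using * l_neg[of n] by (intro frac_le) (auto simp: mult_neg_pos)
  then show "factor (n - int k) - 1 \<le> 4 / - l n * (1/5) ^ k"
    by (simp add: factor_def power_divide)
  show "0 \<le> factor (n - int k) - 1" using l_neg[of "n - int k"] by (simp add: factor_def)
qed

lemma convergent_factor: "convergent_prod (\<lambda>k. factor (n - int k))"
proof (rule abs_convergent_prod_imp_convergent_prod, rule summable_imp_abs_convergent_prod)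
  have "summable (\<lambda>k. 4 / - l n * (1/5 :: real) ^ k)" by (intro summable_mult summable_geometric) simp
  then show "summable (\<lambda>k. norm (factor (n - int k) - 1))"
    by (rule summable_comparison_test') (use factor_bounds in auto)
qed

lemma factor_ge_1: "factor n \<ge> 1"
  using factor_bounds(1)[of n 0] by simp

lemma tail_prod_step: "tail_prod (n + 1) = factor (n + 1) * tail_prod n"
proof -
  have "(\<Prod>k. factor (n + 1 - int (Suc k))) = tail_prod (n + 1) / factor (n + 1)"
    using prodinf_split_head[OF convergent_factor, of "n + 1"] factor_ge_1[of "n + 1"]
    by (simp add: tail_prod_def)
  moreover have "n + 1 - int (Suc k) = n - int k" for k by simp
  ultimately show ?thesis using factor_ge_1[of "n + 1"] by (simp only: tail_prod_def) (simp add: field_simps)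
qed

lemma tail_prod_bounds: "1 \<le> tail_prod n" "tail_prod n \<le> exp (5 / - l n)"
proof -
  show "1 \<le> tail_prod n"
    unfolding tail_prod_def
    by (rule prodinf_nonneg[OF convergent_prod_has_prod[OF convergent_factor] factor_ge_1])
  show "tail_prod n \<le> exp (5 / - l n)"
    unfolding tail_prod_def
  proof (rule prodinf_le_const[OF convergent_factor])
    fix N :: nat
    have "(\<Prod>k<N. factor (n - int k)) = (\<Prod>k<N. 1 + (factor (n - int k) - 1))" by simp
    also have "\<dots> \<le> exp (\<Sum>k<N. factor (n - int k) - 1)"
      by (rule prod_le_exp_sum) (rule factor_bounds)
    also have "(\<Sum>k<N. factor (n - int k) - 1) \<le> (\<Sum>k<N. 4 / - l n * (1/5) ^ k)"
      by (intro sum_mono factor_bounds)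
    also have "\<dots> = 4 / - l n * (\<Sum>k<N. (1/5) ^ k)" by (rule sum_distrib_left[symmetric])
    also have "\<dots> \<le> 4 / - l n * (5/4)"
      using l_neg[of n] sum_le_suminf[of "\<lambda>k. (1/5 :: real) ^ k" "{..<N}"] suminf_geometric[of "1/5 :: real"]
      by (intro mult_left_mono) (auto simp: summable_geometric)
    finally show "(\<Prod>k<N. factor (n - int k)) \<le> exp (5 / - l n)" by simp
  qed
qed

text \<open>
  For vanishing value at \<open>q 0\<close> the recursion multiplies by \<open>(6 - c) / ((2 - c) (5 - c))\<close>
  with \<open>c = l (n + 1)\<close>. Here \<open>1 / (5 - c)\<close> is \<open>l (n + 1) / l n\<close>, which telescopes to \<open>l n\<close>,
  and the other part is \<open>1 + 4 / (2 - c)\<close>, which gives the product over all larger scales.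
\<close>

definition Sval :: "int \<Rightarrow> 3 \<Rightarrow> real" where
  "Sval n j = (if j = 0 then 0 else - l n / 4 * tail_prod n)"

lemma Sval_nonzero: "Sval n 1 \<noteq> 0"
  using l_neg[of n] tail_prod_bounds(1)[of n] by (simp add: Sval_def)

lemma compatible_Sval: "compatible Sval"
proof (rule compatible_even)
  fix n
  have "2 - l (n + 1) \<noteq> 0" "5 - l (n + 1) \<noteq> 0" using l_neg[of "n + 1"] by auto
  then show "Sval (n + 1) 1 = (0 + Sval n 1) / (5 - l (n + 1))
      + 2 * (0 + 2 * Sval n 1) / ((2 - l (n + 1)) * (5 - l (n + 1)))"
    unfolding Sval_def tail_prod_step factor_def l_step[of n]
    by (simp add: divide_simps) (simp add: algebra_simps)
qed (simp_all add: Sval_def)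

text \<open>
  The factors \<open>1 + 4 / (2 - l j)\<close> tend to \<open>3\<close> as \<open>j\<close> grows. After division by \<open>3\<close> they
  differ from \<open>1\<close> by a summable amount, so \<open>3 ^ (- m) tail_prod m\<close> has a nonzero limit, and
  so does \<open>5 ^ m l m\<close>. Their product is the normal derivative, which is the normalising
  constant of the theorem.
\<close>

lemma Sval_normal: "\<exists>k. k \<noteq> 0 \<and> (\<lambda>m. (5/3) ^ m * (- 2 * Sval (int m) 1)) \<longlonglongrightarrow> k"
proof -
  define w where "w k = factor (int (Suc k)) / 3" for k
  have t: "tail_prod (int m) = 3 ^ m * (tail_prod 0 * (\<Prod>k<m. w k))" for m
  proof (induction m)
    case (Suc m)
    have "int (Suc m) = int m + 1" by simp
    then have "tail_prod (int (Suc m)) = 3 * w m * tail_prod (int m)"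
      using tail_prod_step[of "int m"] by (simp only: w_def)
    then show ?case using Suc by simp
  qed simp
  have w: "convergent_prod w"
  proof (rule abs_convergent_prod_imp_convergent_prod, rule summable_imp_abs_convergent_prod)
    have "summable (\<lambda>k. - l 0 * (1/5) ^ k)" by (intro summable_mult summable_geometric) simp
    moreover have "norm (w k - 1) \<le> - l 0 * (1/5) ^ k" for k
    proof -
      let ?c = "l (int (Suc k))"
      have c: "?c < 0" by (rule l_neg)
      have "w k - 1 = 2 * ?c / (6 - 3 * ?c)"
        using c by (simp add: w_def factor_def field_simps)
      then have "norm (w k - 1) = 2 * - ?c / (6 - 3 * ?c)" using c by simp
      also have "\<dots> \<le> 2 * - ?c / 2" using c by (intro divide_left_mono) auto
      also have "\<dots> \<le> - l 0 / 5 ^ Suc k" using l_growth_pow[of 0 "Suc k"] by simp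
      also have "\<dots> \<le> - l 0 / 5 ^ k" using l_neg[of 0] by (intro divide_left_mono) auto
      finally show ?thesis by (simp add: power_divide)
    qed
    ultimately show "summable (\<lambda>k. norm (w k - 1))"
      using summable_comparison_test'[of "\<lambda>k. - l 0 * (1/5) ^ k" 0 "\<lambda>k. norm (w k - 1)"] by simp
  qed
  have "w k \<noteq> 0" for k using factor_ge_1[of "int (Suc k)"] by (simp add: w_def)
  then have nz: "prodinf w \<noteq> 0" using prodinf_nonzero[OF w] by blast
  have "(\<lambda>m. \<Prod>k<m. w k) \<longlonglongrightarrow> prodinf w"
    using convergent_prod_LIMSEQ[OF w] by (simp add: LIMSEQ_lessThan_iff_atMost)
  then have "(\<lambda>m. 1/2 * (5 ^ m * l (int m)) * (tail_prod 0 * (\<Prod>k<m. w k)))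
      \<longlonglongrightarrow> 1/2 * (- (2/3 * lam)) * (tail_prod 0 * prodinf w)"
    by (intro tendsto_intros l_scaled_LIMSEQ)
  moreover have "1/2 * (5 ^ m * l (int m)) * (tail_prod 0 * (\<Prod>k<m. w k)) = (5/3) ^ m * (- 2 * Sval (int m) 1)" for m
    unfolding Sval_def t by (simp add: power_divide)
  ultimately have "(\<lambda>m. (5/3) ^ m * (- 2 * Sval (int m) 1)) \<longlonglongrightarrow> 1/2 * (- (2/3 * lam)) * (tail_prod 0 * prodinf w)"
    by (simp only:)
  moreover have "1/2 * (- (2/3 * lam)) * (tail_prod 0 * prodinf w) \<noteq> 0"
    using lam_pos nz tail_prod_bounds(1)[of 0] by simp
  ultimately show ?thesis by blast
qed

text \<open>
  For odd values the three corner values add up to \<open>0\<close>, so the recursion is multiplication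
  by \<open>1 / (5 - l (n + 1)) = l (n + 1) / l n\<close>, and the value at \<open>x n\<close> is a multiple of \<open>l n\<close>.
  The constant is fixed by the limit \<open>5 ^ m l m \<longlonglongrightarrow> - 2/3 lam\<close>.
\<close>

definition Qval :: "int \<Rightarrow> 3 \<Rightarrow> real" where
  "Qval n j = (if j = 0 then 0 else (if j = 1 then 1 else - 1) * (- (3/4) * (l n / lam)))"

lemma compatible_Qval: "compatible Qval"
  unfolding compatible_def fun_eq_iff
proof (intro allI)
  fix n j
  have "5 - l (n + 1) \<noteq> 0" using l_neg[of "n + 1"] by auto
  then show "extend (l (n + 1)) 0 (Qval n) j = Qval (n + 1) j"
    using three_cases[of j] unfolding Qval_def extend_def sum_three l_step[of n]
    by (auto simp: divide_simps)
qed

lemma Qval_tangential: "(\<lambda>m. 5 ^ m * (2 * Qval (int m) 1)) \<longlonglongrightarrow> 1"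
proof -
  have "(\<lambda>m. - (3 / (2 * lam)) * (5 ^ m * l (int m))) \<longlonglongrightarrow> - (3 / (2 * lam)) * (- (2/3 * lam))"
    by (intro tendsto_mult_left l_scaled_LIMSEQ)
  moreover have "- (3 / (2 * lam)) * (5 ^ m * l (int m)) = 5 ^ m * (2 * Qval (int m) 1)" for m
    by (simp add: Qval_def)
  moreover have "- (3 / (2 * lam)) * (- (2/3 * lam)) = 1" using lam_pos by simp
  ultimately show ?thesis by (simp only:)
qed

section \<open>Identification of the three functions\<close>

lemma glue_q0: "compatible P \<Longrightarrow> glue P (q 0) = P 0 0"
  using glue_corner[of P 0 0] by (simp add: F0_powi_0)

lemma has_normal_deriv_glue:
  assumes "compatible P"
  shows "has_normal_deriv q (glue P) d \<longleftrightarrow>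
    (\<lambda>m. (5/3) ^ m * (2 * P 0 0 - P (int m) 1 - P (int m) 2)) \<longlonglongrightarrow> d"
  unfolding has_normal_deriv_def funpow_F glue_corner[OF assms] glue_q0[OF assms] ..

lemma C_fun_eq: "C_fun q lam = glue Cval"
proof -
  obtain k where k: "k \<noteq> 0" "(\<lambda>m. (5/3) ^ m * (- 2 * Sval (int m) 1)) \<longlonglongrightarrow> k" using Sval_normal by blast
  show ?thesis
    unfolding C_fun_def
  proof (rule the_equality)
    have "even_inf q (glue Cval)" by (rule even_glue[OF compatible_Cval]) (simp add: Cval_def)
    moreover have "has_normal_deriv q (glue Cval) 0"
      unfolding has_normal_deriv_glue[OF compatible_Cval] using Cval_normal by (simp add: Cval_def)
    ultimately show "solution q lam (glue Cval) \<and> even_inf q (glue Cval) \<and> glue Cval (q 0) = 1 \<and>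
        has_normal_deriv q (glue Cval) 0"
      using solution_glue[OF compatible_Cval] glue_q0[OF compatible_Cval] by (simp add: Cval_def)
    fix u assume "solution q lam u \<and> even_inf q u \<and> u (q 0) = 1 \<and> has_normal_deriv q u 0"
    then have "u = glue (\<lambda>n j. 1 * Cval n j + 0 / k * Sval n j)"
      by (intro even_solution_unique[OF compatible_Cval _ _ Cval_normal compatible_Sval _ _ Sval_nonzero k(2,1)])
        (simp_all add: Cval_def Sval_def)
    then show "u = glue Cval" by simp
  qed
qed

lemma S_fun_eq:
  assumes k: "k \<noteq> 0" "(\<lambda>m. (5/3) ^ m * (- 2 * Sval (int m) 1)) \<longlonglongrightarrow> k"
  shows "S_fun q k lam = glue Sval"
  unfolding S_fun_def
proof (rule the_equality)
  have "even_inf q (glue Sval)" by (rule even_glue[OF compatible_Sval]) (simp add: Sval_def)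
  moreover have "has_normal_deriv q (glue Sval) k"
    unfolding has_normal_deriv_glue[OF compatible_Sval] using k(2) by (simp add: Sval_def)
  ultimately show "solution q lam (glue Sval) \<and> even_inf q (glue Sval) \<and> glue Sval (q 0) = 0 \<and>
      has_normal_deriv q (glue Sval) k"
    using solution_glue[OF compatible_Sval] glue_q0[OF compatible_Sval] by (simp add: Sval_def)
  fix u assume "solution q lam u \<and> even_inf q u \<and> u (q 0) = 0 \<and> has_normal_deriv q u k"
  then have "u = glue (\<lambda>n j. 0 * Cval n j + k / k * Sval n j)"
    by (intro even_solution_unique[OF compatible_Cval _ _ Cval_normal compatible_Sval _ _ Sval_nonzero k(2,1)])
      (simp_all add: Cval_def Sval_def)
  then show "u = glue Sval" using k(1) by simp
qed

lemma Q_fun_eq: "Q_fun q lam = glue Qval"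
  unfolding Q_fun_def
proof (rule the_equality)
  have sym: "\<And>n. Qval n 0 = 0" "\<And>n. Qval n 2 = - Qval n 1" by (simp_all add: Qval_def)
  have "has_tangential_deriv q (glue Qval) 1"
    unfolding has_tangential_deriv_def funpow_F glue_corner[OF compatible_Qval]
    using Qval_tangential by (simp add: sym)
  then show "solution q lam (glue Qval) \<and> odd_inf q (glue Qval) \<and> has_tangential_deriv q (glue Qval) 1"
    using solution_glue[OF compatible_Qval] odd_glue[OF compatible_Qval sym] by blast
  have "\<And>n. Qval n 1 \<noteq> 0" using l_neg lam_pos by (simp add: Qval_def less_imp_neq)
  then show "u = glue Qval"
    if "solution q lam u \<and> odd_inf q u \<and> has_tangential_deriv q u 1" for u
    using odd_solution_unique[OF compatible_Qval sym _ Qval_tangential] that by blast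
qed

section \<open>Behaviour far from the corner\<close>

lemma inverse_l_at_bot: "((\<lambda>n. 1 / - l n) \<longlongrightarrow> 0) at_bot"
proof (rule tendsto_sandwich)
  show "\<forall>\<^sub>F n in at_bot. 0 \<le> 1 / - l n" using l_neg by (simp add: less_imp_le)
  have "1 / - l n \<le> 1 / - l 0 * (1/5) ^ nat (- n)" if "n \<le> 0" for n
  proof -
    have "- l 0 \<le> - l n / 5 ^ nat (- n)" using l_growth_pow[of n "nat (- n)"] that by simp
    then have "- l 0 * 5 ^ nat (- n) \<le> - l n" by (simp add: field_simps)
    then have "1 / - l n \<le> 1 / (- l 0 * 5 ^ nat (- n))" using l_neg[of 0] by (intro frac_le) (auto simp: mult_neg_pos)
    then show ?thesis by (simp add: power_divide)
  qed
  then show "\<forall>\<^sub>F n in at_bot. 1 / - l n \<le> 1 / - l 0 * (1/5) ^ nat (- n)"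
    unfolding eventually_at_bot_linorder by blast
  have "filterlim (\<lambda>n. nat (- n)) sequentially at_bot"
    unfolding filterlim_at_top eventually_at_bot_linorder
  proof
    fix Z show "\<exists>N. \<forall>n\<le>N. Z \<le> nat (- n)" by (rule exI[of _ "- int Z"]) auto
  qed
  then have "((\<lambda>n. (1/5 :: real) ^ nat (- n)) \<longlongrightarrow> 0) at_bot"
    using filterlim_compose[OF LIMSEQ_realpow_zero[of "1/5"]] by simp
  from tendsto_mult_left[OF this, of "1 / - l 0"]
  show "((\<lambda>n. 1 / - l 0 * (1/5) ^ nat (- n)) \<longlongrightarrow> 0) at_bot" by simp
qed simp

lemma tail_prod_at_bot: "(tail_prod \<longlongrightarrow> 1) at_bot"
proof (rule tendsto_sandwich[where f="\<lambda>_. 1" and h="\<lambda>n. exp (5 / - l n)"])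
  have "((\<lambda>n. exp (5 * (1 / - l n))) \<longlongrightarrow> exp (5 * 0)) at_bot"
    by (intro tendsto_intros inverse_l_at_bot)
  then show "((\<lambda>n. exp (5 / - l n)) \<longlongrightarrow> 1) at_bot" by simp
  show "\<forall>\<^sub>F n in at_bot. 1 \<le> tail_prod n" "\<forall>\<^sub>F n in at_bot. tail_prod n \<le> exp (5 / - l n)"
    by (intro always_eventually allI tail_prod_bounds)+
qed simp

text \<open>
  Both quotients of the theorem have this form, with \<open>g\<close> the infinite product or the
  constant \<open>3 / lam\<close>.
\<close>

lemma ratio_at_bot:
  assumes "(g \<longlongrightarrow> c) at_bot"
  shows "((\<lambda>n. (- l n / 4 * g n) / (1 - l n / 4)) \<longlongrightarrow> c) at_bot"
proof -
  have "((\<lambda>n. g n / (1 + 4 * (1 / - l n))) \<longlongrightarrow> c / (1 + 4 * 0)) at_bot"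
    by (intro tendsto_intros assms inverse_l_at_bot) simp
  moreover have "g n / (1 + 4 * (1 / - l n)) = (- l n / 4 * g n) / (1 - l n / 4)" for n
  proof -
    have "l n < 0" by (rule l_neg)
    then have "l n \<noteq> 0" "l n - 4 \<noteq> 0" "4 - l n \<noteq> 0" by auto
    then show ?thesis by (simp add: field_simps)
  qed
  ultimately show ?thesis by simp
qed

end

theorem theorem6p3:
  fixes q :: "3 \<Rightarrow> real^2" and lam :: real and l :: "int \<Rightarrow> real" and x :: "int \<Rightarrow> real^2"
  assumes "equilateral q"
    and "lam > 0"
    and "\<And>n. l n < 0"
    and "\<And>n. l (n - 1) = l n * (5 - l n)"
    and "((\<lambda>n::int. 3/2 * 5 powi n * l n) \<longlongrightarrow> - lam) at_top"
    and "\<And>n. x n = F0_powi q n (q 1)"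
  shows
    "(\<forall>n. C_fun q lam (x n) = 1 - l n / 4) \<and>
     (\<exists>a. a \<noteq> 0 \<and>
        (\<forall>n. convergent_prod (\<lambda>k::nat. 1 + 4 / (2 - l (n - int k))) \<and>
             S_fun q a lam (x n) = - l n / 4 * (\<Prod>k::nat. 1 + 4 / (2 - l (n - int k)))) \<and>
        ((\<lambda>n. S_fun q a lam (x n) / C_fun q lam (x n)) \<longlongrightarrow> 1) at_bot) \<and>
     (\<forall>n<0. Q_fun q lam (x n) = - (3/4) * (l n / lam)) \<and>
     ((\<lambda>n. Q_fun q lam (x n) / C_fun q lam (x n)) \<longlongrightarrow> 3 / lam) at_bot"
proof -
  interpret decimation q l lam
    using assms(1-5) by unfold_locales
  have C: "C_fun q lam (x n) = 1 - l n / 4" for n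
    unfolding assms(6) C_fun_eq glue_corner[OF compatible_Cval] by (simp add: Cval_def)
  have Q: "Q_fun q lam (x n) = - (3/4) * (l n / lam)" for n
    unfolding assms(6) Q_fun_eq glue_corner[OF compatible_Qval] by (simp add: Qval_def)
  obtain a where a: "a \<noteq> 0" "(\<lambda>m. (5/3) ^ m * (- 2 * Sval (int m) 1)) \<longlonglongrightarrow> a"
    using Sval_normal by blast
  have S: "S_fun q a lam (x n) = - l n / 4 * tail_prod n" for n
    unfolding assms(6) S_fun_eq[OF a] glue_corner[OF compatible_Sval] by (simp add: Sval_def)
  have SC: "((\<lambda>n. S_fun q a lam (x n) / C_fun q lam (x n)) \<longlongrightarrow> 1) at_bot"
    unfolding S C by (rule ratio_at_bot[OF tail_prod_at_bot])
  have "Q_fun q lam (x n) = - l n / 4 * (3 / lam)" for n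
    unfolding Q by simp
  then have QC: "((\<lambda>n. Q_fun q lam (x n) / C_fun q lam (x n)) \<longlongrightarrow> 3 / lam) at_bot"
    unfolding C by (simp only: ratio_at_bot[OF tendsto_const])
  have conv: "convergent_prod (\<lambda>k::nat. 1 + 4 / (2 - l (n - int k)))" for n
    using convergent_factor unfolding factor_def .
  show ?thesis
    using C Q a(1) S SC QC conv unfolding tail_prod_def factor_def by blast
qed

end
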